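(* Let $G$ be a Tarski monster group. Then the $G$-action on the Furstenberg boundary $\partial_F G$ is topologically free.
   Context: For a prime $p$, a Tarski monster group of order $p$ is a finitely generated non-amenable infinite group in which every nontrivial proper subgroup is cyclic of order $p$. The Furstenberg boundary $\partial_F G$ is the universal $G$-boundary: a compact $G$-space that is minimal (all orbits dense) and strongly proximal (for every probability measure $\nu$ the weak* closure of $G\nu$ contains a point mass), of which every such $G$-space is a continuous $G$-equivariant image. An action of $G$ on a compact space $X$ is topologically free if for every $s\in G\setminus\{e\}$ the set $\{x\in X: sx\neq x\}$ is dense in $X$. *)

theory Defs
  imports "HOL-Probability.Probability" "HOL-Algebra.Algebra"
begin

definition amenable_group :: "('g, 'b) monoid_scheme \<Rightarrow> bool" where
  "amenable_group G \<longleftrightarrow>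
     (\<exists>\<mu> :: 'g set \<Rightarrow> real.
        (\<forall>A. A \<subseteq> carrier G \<longrightarrow> \<mu> A \<ge> 0) \<and>
        \<mu> (carrier G) = 1 \<and>
        (\<forall>A B. A \<subseteq> carrier G \<and> B \<subseteq> carrier G \<and> A \<inter> B = {}
               \<longrightarrow> \<mu> (A \<union> B) = \<mu> A + \<mu> B) \<and>
        (\<forall>g\<in>carrier G. \<forall>A. A \<subseteq> carrier G \<longrightarrow> \<mu> ((\<lambda>h. g \<otimes>\<^bsub>G\<^esub> h) ` A) = \<mu> A))"

definition finitely_generated_group :: "('g, 'b) monoid_scheme \<Rightarrow> bool" where
  "finitely_generated_group G \<longleftrightarrow>
     (\<exists>S. finite S \<and> S \<subseteq> carrier G \<and> generate G S = carrier G)"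

definition tarski_monster :: "('g, 'b) monoid_scheme \<Rightarrow> nat \<Rightarrow> bool" where
  "tarski_monster G p \<longleftrightarrow>
     group G \<and> Factorial_Ring.prime p \<and> finitely_generated_group G \<and> \<not> amenable_group G \<and>
     infinite (carrier G) \<and>
     (\<forall>H. subgroup H G \<and> H \<noteq> {\<one>\<^bsub>G\<^esub>} \<and> H \<noteq> carrier G \<longrightarrow>
          (\<exists>h\<in>H. H = generate G {h}) \<and> card H = p)"

definition borel_of :: "'x topology \<Rightarrow> 'x measure" where
  "borel_of T = measure_of (topspace T) {U. openin T U} (\<lambda>_. 0)"

definition continuous_action ::
  "('g, 'b) monoid_scheme \<Rightarrow> 'x topology \<Rightarrow> ('g \<Rightarrow> 'x \<Rightarrow> 'x) \<Rightarrow> bool" where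
  "continuous_action G S a \<longleftrightarrow>
     (\<forall>g\<in>carrier G. continuous_map S S (a g)) \<and>
     (\<forall>x\<in>topspace S. a \<one>\<^bsub>G\<^esub> x = x) \<and>
     (\<forall>g\<in>carrier G. \<forall>h\<in>carrier G. \<forall>x\<in>topspace S. a (g \<otimes>\<^bsub>G\<^esub> h) x = a g (a h x))"

definition compact_G_space ::
  "('g, 'b) monoid_scheme \<Rightarrow> 'x topology \<Rightarrow> ('g \<Rightarrow> 'x \<Rightarrow> 'x) \<Rightarrow> bool" where
  "compact_G_space G S a \<longleftrightarrow>
     compact_space S \<and> Hausdorff_space S \<and> topspace S \<noteq> {} \<and> continuous_action G S a"

definition minimal_action ::
  "('g, 'b) monoid_scheme \<Rightarrow> 'x topology \<Rightarrow> ('g \<Rightarrow> 'x \<Rightarrow> 'x) \<Rightarrow> bool" where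
  "minimal_action G S a \<longleftrightarrow>
     (\<forall>x\<in>topspace S. S closure_of ((\<lambda>g. a g x) ` carrier G) = topspace S)"

definition prob_measure_on :: "'x topology \<Rightarrow> 'x measure \<Rightarrow> bool" where
  "prob_measure_on S \<nu> \<longleftrightarrow> prob_space \<nu> \<and> sets \<nu> = sets (borel_of S)"

text \<open>Strong proximality: for every probability measure \<nu>, the weak* closure of
the orbit G\<nu> contains a point mass \<delta>_x.  Weak* neighbourhoods of \<delta>_x are given by
finitely many continuous real functions and a tolerance; the integral of f against
the translate g\<nu> is the integral of f \<circ> a g against \<nu>.\<close>
definition strongly_proximal ::
  "('g, 'b) monoid_scheme \<Rightarrow> 'x topology \<Rightarrow> ('g \<Rightarrow> 'x \<Rightarrow> 'x) \<Rightarrow> bool" where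
  "strongly_proximal G S a \<longleftrightarrow>
     (\<forall>\<nu>. prob_measure_on S \<nu> \<longrightarrow>
        (\<exists>x\<in>topspace S. \<forall>F \<epsilon>. finite F \<and> (\<forall>f\<in>F. continuous_map S euclideanreal f) \<and> \<epsilon> > 0
            \<longrightarrow> (\<exists>g\<in>carrier G. \<forall>f\<in>F. \<bar>(\<integral>y. f (a g y) \<partial>\<nu>) - f x\<bar> < (\<epsilon>::real))))"

definition G_boundary ::
  "('g, 'b) monoid_scheme \<Rightarrow> 'x topology \<Rightarrow> ('g \<Rightarrow> 'x \<Rightarrow> 'x) \<Rightarrow> bool" where
  "G_boundary G S a \<longleftrightarrow>
     compact_G_space G S a \<and> minimal_action G S a \<and> strongly_proximal G S a"

definition equivariant_factor ::
  "('g, 'b) monoid_scheme \<Rightarrow> 'x topology \<Rightarrow> ('g \<Rightarrow> 'x \<Rightarrow> 'x)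
     \<Rightarrow> 'y topology \<Rightarrow> ('g \<Rightarrow> 'y \<Rightarrow> 'y) \<Rightarrow> ('x \<Rightarrow> 'y) \<Rightarrow> bool" where
  "equivariant_factor G S a Y b \<pi> \<longleftrightarrow>
     continuous_map S Y \<pi> \<and> \<pi> ` topspace S = topspace Y \<and>
     (\<forall>g\<in>carrier G. \<forall>x\<in>topspace S. \<pi> (a g x) = b g (\<pi> x))"

text \<open>Furstenberg boundary: a G-boundary of which every G-boundary is a
continuous equivariant image.  HOL cannot quantify over all types inside a
formula, so the universal property is quantified over all G-boundaries carried
by the type 'g set set.  Every G-boundary is a continuous image of the
Stone-Cech compactification of G (i.e. of the ultrafilters on carrier G, which
live in 'g set set), so every G-boundary has an isomorphic copy on this type,
and this restricted universality is equivalent to the usual one.\<close>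
definition furstenberg_boundary ::
  "('g, 'b) monoid_scheme \<Rightarrow> 'x topology \<Rightarrow> ('g \<Rightarrow> 'x \<Rightarrow> 'x) \<Rightarrow> bool" where
  "furstenberg_boundary G S a \<longleftrightarrow>
     G_boundary G S a \<and>
     (\<forall>(Y :: 'g set set topology) b. G_boundary G Y b \<longrightarrow> (\<exists>\<pi>. equivariant_factor G S a Y b \<pi>))"

definition topologically_free ::
  "('g, 'b) monoid_scheme \<Rightarrow> 'x topology \<Rightarrow> ('g \<Rightarrow> 'x \<Rightarrow> 'x) \<Rightarrow> bool" where
  "topologically_free G S a \<longleftrightarrow>
     (\<forall>s\<in>carrier G - {\<one>\<^bsub>G\<^esub>}. S closure_of {x\<in>topspace S. a s x \<noteq> x} = topspace S)"

end

theory Submission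
  imports Defs
begin

text \<open>
  Suppose first that the boundary has no global fixed point. If some \<open>s \<noteq> 1\<close> fixes a nonempty open set
  pointwise, then by minimality and compactness finitely many translates of that set cover the space, so
  every point stabilizer contains one of finitely many nontrivial elements. Stabilizers are proper, and
  proper subgroups of a Tarski monster that share a nontrivial element coincide; hence there are only
  finitely many stabilizers. Some stabilizer then has an infinite normalizer, which must be the whole group,
  and this contradicts the simplicity of the Tarski monster.

  A global fixed point of a minimal action is the whole space, and then every boundary is a point. To
  contradict non-amenability, let \<open>K\<close> be a minimal closed convex invariant set of finitely additive means on
  the group. The closure of the extreme points of \<open>K\<close> is a boundary: the barycenters of convex
  combinations of translates of a measure \<open>\<nu>\<close> are dense in \<open>K\<close>, and a measure whose barycenter is close to
  an extreme point \<open>x\<close> must be concentrated near \<open>x\<close>, so some translate of \<open>\<nu>\<close> is. If this boundary is a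
  point, it is an invariant mean.
\<close>

section \<open>Compact convex sets of real functions\<close>

lemma Hausdorff_space_fun: "Hausdorff_space (euclidean :: ('i \<Rightarrow> real) topology)"
  by (subst euclidean_product_topology[symmetric]) (simp add: Hausdorff_space_product_topology)

lemma compact_imp_closed_fun:
  fixes K :: "('i \<Rightarrow> real) set"
  assumes "compact K"
  shows "closed K"
  using compactin_imp_closedin[OF Hausdorff_space_fun, of K] assms by simp

text \<open>In a chain the smallest member of a finite subfamily lies in all the others, so the
  finite intersection property can be applied inside any one compact member.\<close>

lemma compact_chain_Inter_nonempty:
  fixes \<F> :: "('i \<Rightarrow> real) set set"
  assumes compact: "\<And>S. S \<in> \<F> \<Longrightarrow> compact S" and ne: "{} \<notin> \<F>" "\<F> \<noteq> {}"
    and chain: "\<And>S T. S \<in> \<F> \<Longrightarrow> T \<in> \<F> \<Longrightarrow> S \<subseteq> T \<or> T \<subseteq> S"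
  shows "\<Inter>\<F> \<noteq> {}"
proof -
  obtain S where S: "S \<in> \<F>" using ne by blast
  have fin: "\<exists>T\<in>\<F>. T \<subseteq> \<Inter>\<B>" if "finite \<B>" "\<B> \<subseteq> \<F>" for \<B>
    using that
  proof (induction \<B>)
    case empty
    then show ?case using S by auto
  next
    case (insert B \<B>)
    then obtain T where T: "T \<in> \<F>" "T \<subseteq> \<Inter>\<B>" by auto
    have B: "B \<in> \<F>" using insert.prems by blast
    show ?case
    proof (cases "B \<subseteq> T")
      case True
      then show ?thesis using B T by (intro bexI[of _ B]) auto
    next
      case False
      then have "T \<subseteq> B" using chain B T by blast
      then show ?thesis using T by (intro bexI[of _ T]) auto
    qed
  qed
  have "S \<inter> \<Inter>\<F> \<noteq> {}"
  proof (rule compact_imp_fip[OF compact[OF S]])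
    show "closed T" if "T \<in> \<F>" for T using that compact compact_imp_closed_fun by blast
    show "S \<inter> \<Inter>\<B> \<noteq> {}" if \<B>: "finite \<B>" "\<B> \<subseteq> \<F>" for \<B>
    proof -
      obtain T where "T \<in> \<F>" "T \<subseteq> \<Inter>(insert S \<B>)"
        using fin[of "insert S \<B>"] \<B> S by auto
      moreover from this have "T \<noteq> {}" using ne by metis
      ultimately show ?thesis by (metis Inter_insert subset_empty)
    qed
  qed
  then show ?thesis by blast
qed

text \<open>\<open>Q\<close> stands for any property stable under intersections. It is instantiated
  twice: with faces, to find extreme points, and with convex invariant sets of means.\<close>

lemma exists_minimal_compact:
  fixes C :: "('i \<Rightarrow> real) set"
  assumes C: "compact C" "C \<noteq> {}" "Q C"
    and Inter: "\<And>\<F>. \<F> \<noteq> {} \<Longrightarrow> \<forall>S\<in>\<F>. Q S \<Longrightarrow> Q (\<Inter>\<F>)"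
  shows "\<exists>M\<subseteq>C. compact M \<and> M \<noteq> {} \<and> Q M \<and>
    (\<forall>N\<subseteq>M. compact N \<and> N \<noteq> {} \<and> Q N \<longrightarrow> N = M)"
proof -
  \<comment> \<open>Complements turn minimal sets into maximal ones and intersections of chains into
    unions, which is the form of Zorn's lemma applied next.\<close>
  define \<S> where "\<S> = uminus ` {S. S \<subseteq> C \<and> compact S \<and> S \<noteq> {} \<and> Q S}"
  have "\<exists>M\<in>\<S>. \<forall>W\<in>\<S>. M \<subseteq> W \<longrightarrow> W = M"
  proof (rule subset_Zorn_nonempty)
    show "\<S> \<noteq> {}" using C by (auto simp: \<S>_def)
    fix \<C> assume ne: "\<C> \<noteq> {}" and chain: "subset.chain \<S> \<C>"
    define \<F> where "\<F> = uminus ` \<C>"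
    have sub: "S \<subseteq> C \<and> compact S \<and> S \<noteq> {} \<and> Q S" if "S \<in> \<F>" for S
      using that chain by (auto simp: \<F>_def \<S>_def subset_chain_def)
    have tot: "S \<subseteq> T \<or> T \<subseteq> S" if "S \<in> \<F>" "T \<in> \<F>" for S T
      using that chain by (auto simp: \<F>_def subset_chain_def)
    have neF: "\<F> \<noteq> {}" using ne by (auto simp: \<F>_def)
    have "compact (\<Inter>\<F>)"
    proof -
      obtain S where S: "S \<in> \<F>" using neF by blast
      have "closed (\<Inter>\<F>)" using sub compact_imp_closed_fun by blast
      then have "compact (S \<inter> \<Inter>\<F>)" using sub S by (intro compact_Int_closed) auto
      moreover have "S \<inter> \<Inter>\<F> = \<Inter>\<F>" using S by blast
      ultimately show ?thesis by simp
    qed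
    moreover have "\<Inter>\<F> \<noteq> {}"
      using compact_chain_Inter_nonempty[of \<F>] sub tot neF by blast
    moreover have "Q (\<Inter>\<F>)" using Inter[of \<F>] neF sub by blast
    moreover have "\<Inter>\<F> \<subseteq> C" using neF sub by blast
    moreover have "\<Union>\<C> = - \<Inter>\<F>" by (auto simp: \<F>_def)
    ultimately show "\<Union>\<C> \<in> \<S>" by (auto simp: \<S>_def)
  qed
  then obtain M where M: "M \<subseteq> C" "compact M" "M \<noteq> {}" "Q M"
    and max: "\<forall>W\<in>\<S>. - M \<subseteq> W \<longrightarrow> W = - M"
    by (auto simp: \<S>_def)
  have "N = M" if "N \<subseteq> M" "compact N" "N \<noteq> {}" "Q N" for N
  proof -
    have "- N \<in> \<S>" using that M by (auto simp: \<S>_def)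
    then have "- N = - M" using max that by blast
    then show "N = M" by blast
  qed
  then show ?thesis using M by blast
qed

section \<open>Neighbourhoods and closures in the product topology\<close>

lemma open_fun_contains_box:
  fixes U :: "('i \<Rightarrow> real) set"
  assumes "open U" "x \<in> U"
  obtains F e where "finite F" "e > 0" "\<And>y. (\<And>i. i \<in> F \<Longrightarrow> \<bar>y i - x i\<bar> < e) \<Longrightarrow> y \<in> U"
proof -
  obtain W where W: "x \<in> (\<Pi>\<^sub>E i\<in>UNIV. W i)" "\<And>i. open (W i)" "finite {i. W i \<noteq> UNIV}"
    "(\<Pi>\<^sub>E i\<in>UNIV. W i) \<subseteq> U"
    using product_topology_open_contains_basis[of "\<lambda>i. euclidean" UNIV U x] assms
    unfolding open_fun_def by auto
  define F where "F = {i. W i \<noteq> UNIV}"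
  have "\<forall>i. \<exists>e>0. \<forall>t. \<bar>t - x i\<bar> < e \<longrightarrow> t \<in> W i"
    using W(1,2) unfolding open_dist dist_real_def by (auto simp: PiE_iff)
  then obtain e where e: "\<And>i. e i > 0" "\<And>i t. \<bar>t - x i\<bar> < e i \<Longrightarrow> t \<in> W i" by metis
  \<comment> \<open>The element 1 keeps the minimum defined when \<open>F\<close> is empty.\<close>
  define d where "d = Min (insert 1 (e ` F))"
  have fin: "finite F" using W by (simp add: F_def)
  have "d > 0" unfolding d_def using fin e(1) by (subst Min_gr_iff) auto
  moreover have dle: "d \<le> e i" if "i \<in> F" for i
    unfolding d_def using fin that by (intro Min_le) auto
  have "y \<in> U" if "\<And>i. i \<in> F \<Longrightarrow> \<bar>y i - x i\<bar> < d" for y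
  proof -
    have "y i \<in> W i" for i
      using that[of i] dle[of i] e(2)[of "y i" i] by (cases "i \<in> F") (auto simp: F_def)
    then show ?thesis using W(4) by (auto simp: PiE_iff)
  qed
  ultimately show thesis using that[of F d] fin by blast
qed

lemma in_closure_funI:
  fixes K :: "('i \<Rightarrow> real) set"
  assumes "\<And>F e. finite F \<Longrightarrow> e > 0 \<Longrightarrow> \<exists>k\<in>K. \<forall>i\<in>F. \<bar>k i - x i\<bar> < e"
  shows "x \<in> closure K"
  unfolding closure_iff_nhds_not_empty
proof (intro allI impI)
  fix A V assume "V \<subseteq> A" "open V" "x \<in> V"
  then obtain F e where "finite F" "e > 0" "\<And>y. (\<And>i. i \<in> F \<Longrightarrow> \<bar>y i - x i\<bar> < e) \<Longrightarrow> y \<in> V"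
    using open_fun_contains_box by metis
  then show "K \<inter> A \<noteq> {}" using assms[of F e] \<open>V \<subseteq> A\<close> by blast
qed

lemma compact_unit_cube: "compact {v :: 'i \<Rightarrow> real. \<forall>i. v i \<in> {0..1}}"
proof -
  have "compactin (product_topology (\<lambda>i. euclideanreal) UNIV) (\<Pi>\<^sub>E i\<in>(UNIV::'i set). {0..1::real})"
    by (subst compactin_PiE) auto
  moreover have "(\<Pi>\<^sub>E i\<in>(UNIV::'i set). {0..1::real}) = {v. \<forall>i. v i \<in> {0..1}}"
    by (auto simp: PiE_iff)
  ultimately show ?thesis by (simp add: euclidean_product_topology)
qed

text \<open>The function space carries no \<open>real_vector\<close> instance, so convexity is spelled out.\<close>

definition mix :: "real \<Rightarrow> ('i \<Rightarrow> real) \<Rightarrow> ('i \<Rightarrow> real) \<Rightarrow> 'i \<Rightarrow> real" where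
  "mix t u v = (\<lambda>i. (1 - t) * u i + t * v i)"

definition mix_closed :: "('i \<Rightarrow> real) set \<Rightarrow> bool" where
  "mix_closed K \<longleftrightarrow> (\<forall>u\<in>K. \<forall>v\<in>K. \<forall>t\<in>{0..1}. mix t u v \<in> K)"

lemma continuous_on_coordinate: "continuous_on S (\<lambda>x::'i \<Rightarrow> real. x i)"
  by (rule continuous_on_subset[OF continuous_on_product_coordinates subset_UNIV])

lemma continuous_on_mix:
  fixes u v :: "'a::topological_space \<Rightarrow> 'i \<Rightarrow> real"
  assumes "continuous_on S t" "continuous_on S u" "continuous_on S v"
  shows "continuous_on S (\<lambda>x. mix (t x) (u x) (v x))"
  unfolding mix_def
proof (rule continuous_on_coordinatewise_then_product)
  fix i
  have "continuous_on S (\<lambda>x. u x i)" "continuous_on S (\<lambda>x. v x i)"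
    by (rule continuous_on_product_then_coordinatewise[OF assms(2)],
        rule continuous_on_product_then_coordinatewise[OF assms(3)])
  then show "continuous_on S (\<lambda>x. (1 - t x) * u x i + t x * v x i)"
    using assms(1) by (intro continuous_intros)
qed

text \<open>The weights are left unnormalized, with \<open>a + b\<close> multiplied out. A vanishing
  total weight is thereby included, and any point of \<open>K\<close> serves in that case.\<close>

lemma mix_closed_combination:
  assumes K: "mix_closed K" "u \<in> K" "v \<in> K" and "a \<ge> 0" "b \<ge> 0"
  obtains k where "k \<in> K" "\<And>i. a * u i + b * v i = (a + b) * k i"
proof (cases "a + b = 0")
  case True
  then have "a = 0" "b = 0" using assms by auto
  then show ?thesis using that K by auto
next
  case False
  then have "mix (b / (a + b)) u v \<in> K"
    using assms by (auto simp: mix_closed_def divide_simps)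
  moreover have "a * u i + b * v i = (a + b) * mix (b / (a + b)) u v i" for i
  proof -
    have "(a + b) * mix (b / (a + b)) u v i = ((a + b) - (a + b) * (b / (a + b))) * u i + ((a + b) * (b / (a + b))) * v i"
      unfolding mix_def by (simp only: algebra_simps)
    then show ?thesis using False by simp
  qed
  ultimately show ?thesis using that by blast
qed

lemma mix_closed_sum:
  assumes "finite J" "mix_closed K" "K \<noteq> {}" "\<And>j. j \<in> J \<Longrightarrow> w j \<ge> 0" "\<And>j. j \<in> J \<Longrightarrow> u j \<in> K"
  shows "\<exists>k\<in>K. \<forall>i. (\<Sum>j\<in>J. w j * u j i) = (\<Sum>j\<in>J. w j) * k i"
  using assms(1,4,5)
proof (induction J)
  case empty
  then show ?case using assms(3) by auto
next
  case (insert j J)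
  then obtain k where k: "k \<in> K" "\<forall>i. (\<Sum>j\<in>J. w j * u j i) = (\<Sum>j\<in>J. w j) * k i" by auto
  have "(\<Sum>j\<in>J. w j) \<ge> 0" by (intro sum_nonneg) (use insert in auto)
  with mix_closed_combination[OF assms(2), of "u j" k "w j" "\<Sum>j\<in>J. w j"] k insert.prems
  obtain k' where "k' \<in> K" "\<And>i. w j * u j i + (\<Sum>j\<in>J. w j) * k i = (w j + (\<Sum>j\<in>J. w j)) * k' i"
    by auto
  then show ?case using insert k by (auto simp: sum.insert)
qed

lemma mix_closed_closure:
  assumes "mix_closed (K :: ('i \<Rightarrow> real) set)"
  shows "mix_closed (closure K)"
proof -
  have "mix t u v \<in> closure K" if "t \<in> {0..1}" "u \<in> closure K" "v \<in> closure K" for t u v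
  proof -
    have cont: "continuous_on (closure (K \<times> K)) (\<lambda>z. mix t (fst z) (snd z))"
      by (intro continuous_on_mix continuous_intros)
    have "(\<lambda>z. mix t (fst z) (snd z)) ` (K \<times> K) \<subseteq> closure K"
      using assms that(1) closure_subset[of K] by (auto simp: mix_closed_def)
    from image_closure_subset[OF cont closed_closure this]
    have "(\<lambda>z. mix t (fst z) (snd z)) ` closure (K \<times> K) \<subseteq> closure K" .
    then have "mix t (fst (u, v)) (snd (u, v)) \<in> closure K"
      using that unfolding closure_Times by blast
    then show ?thesis by simp
  qed
  then show ?thesis by (simp add: mix_closed_def)
qed

section \<open>Extreme points and convex hulls\<close>

definition extreme_pt :: "('i \<Rightarrow> real) set \<Rightarrow> ('i \<Rightarrow> real) \<Rightarrow> bool" where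
  "extreme_pt K x \<longleftrightarrow> x \<in> K \<and> (\<forall>u\<in>K. \<forall>v\<in>K. \<forall>t\<in>{0<..<1}. x = mix t u v \<longrightarrow> u = x \<and> v = x)"

text \<open>A minimal closed face is a point, since each coordinate is maximized on a smaller closed face.\<close>

lemma exists_extreme_pt:
  fixes K :: "('i \<Rightarrow> real) set"
  assumes "compact K" "K \<noteq> {}"
  shows "\<exists>x. extreme_pt K x"
proof -
  \<comment> \<open>\<open>Q F\<close> says that \<open>F\<close> is an extremal subset (a face) of
    \<open>K\<close>.\<close>
  define Q where "Q F \<longleftrightarrow> F \<subseteq> K \<and> (\<forall>u\<in>K. \<forall>v\<in>K. \<forall>t\<in>{0<..<1}. mix t u v \<in> F \<longrightarrow> u \<in> F \<and> v \<in> F)" for F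
  have QK: "Q K" by (auto simp: Q_def)
  have QInter: "Q (\<Inter>\<F>)" if "\<F> \<noteq> {}" "\<forall>S\<in>\<F>. Q S" for \<F>
    unfolding Q_def
  proof (intro conjI ballI impI)
    show "\<Inter>\<F> \<subseteq> K" using that unfolding Q_def by blast
    fix u v t assume uv: "u \<in> K" "v \<in> K" "t \<in> {0<..<1::real}" "mix t u v \<in> \<Inter>\<F>"
    have "u \<in> S \<and> v \<in> S" if S: "S \<in> \<F>" for S
    proof -
      have "mix t u v \<in> S" using uv S by blast
      then show ?thesis using \<open>\<forall>S\<in>\<F>. Q S\<close> S uv(1-3) unfolding Q_def by blast
    qed
    then show "u \<in> \<Inter>\<F>" "v \<in> \<Inter>\<F>" by blast+
  qed
  obtain M where M: "M \<subseteq> K" "compact M" "M \<noteq> {}" "Q M"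
    and min: "\<And>N. N \<subseteq> M \<Longrightarrow> compact N \<Longrightarrow> N \<noteq> {} \<Longrightarrow> Q N \<Longrightarrow> N = M"
    using exists_minimal_compact[of K Q, OF assms QK QInter] by auto
  have eq: "y = z" if "y \<in> M" "z \<in> M" for y z
  proof
    fix i
    obtain m where m: "m \<in> M" "\<And>x. x \<in> M \<Longrightarrow> x i \<le> m i"
      using continuous_attains_sup[OF M(2,3) continuous_on_coordinate] by blast
    define N where "N = {x\<in>M. x i = m i}"
    have "closed {x::'i \<Rightarrow> real. x i = m i}"
      by (intro closed_Collect_eq continuous_on_coordinate continuous_on_const)
    then have "compact (M \<inter> {x. x i = m i})" using M(2) by (rule compact_Int_closed[rotated])
    moreover have "M \<inter> {x. x i = m i} = N" by (auto simp: N_def)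
    ultimately have "compact N" by simp
    moreover have "Q N"
      unfolding Q_def
    proof (intro conjI ballI impI)
      show "N \<subseteq> K" using M by (auto simp: N_def)
      fix u v t assume u: "u \<in> K" "v \<in> K" and t: "t \<in> {0<..<1::real}" and mN: "mix t u v \<in> N"
      then have "mix t u v \<in> M" by (auto simp: N_def)
      then have uv: "u \<in> M" "v \<in> M" using M(4) u t unfolding Q_def by blast+
      \<comment> \<open>Both gaps \<open>m i - u i\<close> and \<open>m i - v i\<close> are
        nonnegative, and a combination of them with positive weights is zero. So both vanish, and
        the maximum is attained at \<open>u\<close> and \<open>v\<close> too.\<close>
      have e: "(1 - t) * (m i - u i) + t * (m i - v i) = 0"
        using mN by (simp add: N_def mix_def algebra_simps)
      have "(1 - t) * (m i - u i) \<ge> 0" "t * (m i - v i) \<ge> 0" using t m(2) uv by auto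
      then have "(1 - t) * (m i - u i) = 0" "t * (m i - v i) = 0" using e by linarith+
      then show "u \<in> N" "v \<in> N" using t uv by (auto simp: N_def)
    qed
    moreover have "m \<in> N" "N \<subseteq> M" using m by (auto simp: N_def)
    ultimately have "N = M" using min by blast
    then have "y \<in> N" "z \<in> N" using that by auto
    then show "y i = z i" by (simp add: N_def)
  qed
  obtain x where "x \<in> M" using M by blast
  then have "extreme_pt K x"
    unfolding extreme_pt_def
  proof (intro conjI ballI impI)
    show "x \<in> K" using \<open>x \<in> M\<close> M by blast
    fix u v t assume "u \<in> K" "v \<in> K" "t \<in> {0<..<1::real}" "x = mix t u v"
    then have "u \<in> M" "v \<in> M" using M(4) \<open>x \<in> M\<close> unfolding Q_def by blast+
    then show "u = x" "v = x" using eq \<open>x \<in> M\<close> by blast+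
  qed
  then show ?thesis by blast
qed

text \<open>The convex hull, generated inductively so that a statement passes from the generators to
  all convex combinations whenever it cuts out a convex set. It is applied below to functionals
  rather than to points.\<close>

inductive_set mix_hull :: "('i \<Rightarrow> real) set \<Rightarrow> ('i \<Rightarrow> real) set" for A where
  base: "u \<in> A \<Longrightarrow> u \<in> mix_hull A"
| mix: "u \<in> mix_hull A \<Longrightarrow> v \<in> mix_hull A \<Longrightarrow> t \<in> {0..1} \<Longrightarrow> mix t u v \<in> mix_hull A"

lemma mix_hull_minimal: "A \<subseteq> C \<Longrightarrow> mix_closed C \<Longrightarrow> mix_hull A \<subseteq> C"
proof
  fix u assume "A \<subseteq> C" "mix_closed C" "u \<in> mix_hull A"
  from this(3) show "u \<in> C"
    by induction (use \<open>A \<subseteq> C\<close> \<open>mix_closed C\<close> in \<open>auto simp: mix_closed_def\<close>)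
qed

section \<open>Barycenters\<close>

text \<open>A Riemann sum argument: replacing \<open>d\<close> by a sample value on each cell of a
  grid of side \<open>1/N\<close> turns the integral into a finite combination of points of
  \<open>K\<close>, and costs at most \<open>1/N\<close> times the total weight.\<close>

lemma (in prob_space) weighted_barycenter_approx:
  fixes d :: "'a \<Rightarrow> 'i \<Rightarrow> real" and N :: nat
  assumes K: "mix_closed K" and cube: "\<And>k i. k \<in> K \<Longrightarrow> k i \<in> {0..1}"
    and d: "\<And>y. y \<in> space M \<Longrightarrow> d y \<in> K" and md [measurable]: "\<And>i. (\<lambda>y. d y i) \<in> borel_measurable M"
    and h [measurable]: "h \<in> borel_measurable M" and h01: "\<And>y. y \<in> space M \<Longrightarrow> h y \<in> {0..1}"
    and F: "finite F" and N: "N > 0"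
  shows "\<exists>k\<in>K. \<forall>i\<in>F. \<bar>(\<integral>y. h y * d y i \<partial>M) - (\<integral>y. h y \<partial>M) * k i\<bar> \<le> (\<integral>y. h y \<partial>M) / N"
proof -
  \<comment> \<open>\<open>q y\<close> names the grid cell of the \<open>F\<close>-coordinates of
    \<open>d y\<close>. These lie in the unit interval, so only finitely many cells are
    occupied.\<close>
  define q where "q y = (\<lambda>i\<in>F. \<lfloor>N * d y i\<rfloor>)" for y
  define J where "J = q ` space M"
  have "q y \<in> (\<Pi>\<^sub>E i\<in>F. {0..int N})" if "y \<in> space M" for y
  proof -
    have "0 \<le> \<lfloor>N * d y i\<rfloor> \<and> \<lfloor>N * d y i\<rfloor> \<le> int N" for i
    proof -
      have "0 \<le> d y i" "d y i \<le> 1" using cube[OF d[OF that], of i] by auto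
      then have "0 \<le> N * d y i" "N * d y i \<le> N * 1" using N by (auto intro: mult_left_mono)
      then show ?thesis by linarith
    qed
    then show ?thesis by (auto simp: q_def)
  qed
  then have "J \<subseteq> (\<Pi>\<^sub>E i\<in>F. {0..int N})" by (auto simp: J_def)
  then have finJ: "finite J" using F by (meson finite_PiE finite_atLeastAtMost_int finite_subset)
  \<comment> \<open>\<open>r j\<close> is a sample point in the occupied cell
    \<open>j\<close>.\<close>
  define r where "r j = (SOME y. y \<in> space M \<and> q y = j)" for j
  have r: "r j \<in> space M \<and> q (r j) = j" if "j \<in> J" for j
    unfolding r_def by (rule someI_ex) (use that in \<open>auto simp: J_def\<close>)
  define P where "P j = {y \<in> space M. q y = j}" for j
  have P [measurable]: "P j \<in> sets M" if "j \<in> J" for j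
  proof -
    have "q y = j \<longleftrightarrow> (\<forall>i\<in>F. \<lfloor>N * d y i\<rfloor> = j i)" for y
    proof -
      have "j \<in> extensional F" using that by (auto simp: J_def q_def)
      then show ?thesis unfolding q_def by (auto simp: fun_eq_iff restrict_def extensional_def)
    qed
    then have "P j = {y \<in> space M. \<forall>i\<in>F. \<lfloor>N * d y i\<rfloor> = j i}" by (simp add: P_def)
    also have "\<dots> \<in> sets M" using F by measurable
    finally show ?thesis .
  qed
  have int: "integrable M (\<lambda>y. h y * f y)" if "f \<in> borel_measurable M" "\<And>y. y \<in> space M \<Longrightarrow> f y \<in> {0..1}" for f
  proof (rule integrable_const_bound[where B = 1])
    show "AE y in M. norm (h y * f y) \<le> 1"
    proof (rule AE_I2)
      fix y assume "y \<in> space M"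
      then have "0 \<le> h y" "h y \<le> 1" "0 \<le> f y" "f y \<le> 1" using h01 that(2) by auto
      then show "norm (h y * f y) \<le> 1" by (simp add: mult_le_one abs_mult)
    qed
  qed (use that in measurable)
  define w where "w j = (\<integral>y. h y * indicator (P j) y \<partial>M)" for j
  have w0: "w j \<ge> 0" for j
    unfolding w_def using h01 by (intro Bochner_Integration.integral_nonneg) (auto simp: indicator_def)
  have split: "(\<Sum>j\<in>J. indicator (P j) y * f j) = f (q y)" if "y \<in> space M" for y and f :: "_ \<Rightarrow> real"
  proof -
    have "(\<Sum>j\<in>J. indicator (P j) y * f j) = (\<Sum>j\<in>J. if q y = j then f j else 0)"
      using that by (intro sum.cong) (auto simp: P_def)
    then show ?thesis using that finJ by (simp add: J_def)
  qed
  have intP: "integrable M (\<lambda>y. h y * indicator (P j) y)" if "j \<in> J" for j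
    using that by (intro int) (auto simp: indicator_def)
  \<comment> \<open>Integrals of functions that are constant on cells are finite sums, with
    \<open>w j\<close> the \<open>h\<close>-weighted mass of the cell \<open>j\<close>.\<close>
  have sumw: "(\<integral>y. h y * f (q y) \<partial>M) = (\<Sum>j\<in>J. w j * f j)" for f :: "_ \<Rightarrow> real"
  proof -
    have "(\<integral>y. h y * f (q y) \<partial>M) = (\<integral>y. (\<Sum>j\<in>J. (h y * indicator (P j) y) * f j) \<partial>M)"
      by (intro Bochner_Integration.integral_cong refl)
         (simp add: split[symmetric] sum_distrib_left mult.assoc)
    also have "\<dots> = (\<Sum>j\<in>J. w j * f j)"
      unfolding w_def using intP by (subst Bochner_Integration.integral_sum) auto
    finally show ?thesis .
  qed
  obtain y0 where "y0 \<in> space M" using not_empty by blast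
  then have "K \<noteq> {}" using d by blast
  then obtain k where k: "k \<in> K" "\<And>i. (\<Sum>j\<in>J. w j * d (r j) i) = (\<Sum>j\<in>J. w j) * k i"
    using mix_closed_sum[OF finJ K, of w "\<lambda>j. d (r j)"] w0 r d by blast
  have W: "(\<Sum>j\<in>J. w j) = (\<integral>y. h y \<partial>M)" using sumw[of "\<lambda>_. 1"] by simp
  have "\<bar>(\<integral>y. h y * d y i \<partial>M) - (\<integral>y. h y \<partial>M) * k i\<bar> \<le> (\<integral>y. h y \<partial>M) / N" if i: "i \<in> F" for i
  proof -
    have m: "(\<lambda>y. d (r (q y)) i) \<in> borel_measurable M"
    proof (subst measurable_cong)
      show "d (r (q y)) i = (\<Sum>j\<in>J. indicator (P j) y * d (r j) i)" if "y \<in> space M" for y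
        using split[OF that, of "\<lambda>j. d (r j) i"] by simp
    qed (use finJ in measurable)
    have qJ: "q y \<in> J" if "y \<in> space M" for y using that by (simp add: J_def)
    have i1: "integrable M (\<lambda>y. h y * d y i)" using cube d by (intro int) auto
    have i2: "integrable M (\<lambda>y. h y * d (r (q y)) i)" 
      using cube d r qJ by (intro int m) blast
    have i3: "integrable M h" using int[of "\<lambda>_. 1"] by simp
    have close: "\<bar>d y i - d (r (q y)) i\<bar> \<le> 1 / N" if y: "y \<in> space M" for y
    proof -
      have "q (r (q y)) i = q y i" using r[OF qJ[OF y]] by simp
      then have "\<lfloor>N * d (r (q y)) i\<rfloor> = \<lfloor>N * d y i\<rfloor>" using i by (simp add: q_def)
      then have "\<bar>N * d y i - N * d (r (q y)) i\<bar> \<le> 1" by linarith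
      moreover have "N * \<bar>d y i - d (r (q y)) i\<bar> = \<bar>N * (d y i - d (r (q y)) i)\<bar>"
        by (simp add: abs_mult)
      ultimately have "N * \<bar>d y i - d (r (q y)) i\<bar> \<le> 1"
        by (simp add: right_diff_distrib)
      then show ?thesis using N by (simp add: field_simps)
    qed
    have "(\<integral>y. h y \<partial>M) * k i = (\<integral>y. h y * d (r (q y)) i \<partial>M)"
      using k(2) W sumw[of "\<lambda>j. d (r j) i"] by simp
    then have "(\<integral>y. h y * d y i \<partial>M) - (\<integral>y. h y \<partial>M) * k i = (\<integral>y. h y * d y i - h y * d (r (q y)) i \<partial>M)"
      using i1 i2 by simp
    also have "\<bar>\<dots>\<bar> \<le> (\<integral>y. \<bar>h y * d y i - h y * d (r (q y)) i\<bar> \<partial>M)"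
      using integral_abs_bound by blast
    also have "\<dots> \<le> (\<integral>y. h y * (1 / N) \<partial>M)"
    proof (rule integral_mono)
      show "integrable M (\<lambda>y. \<bar>h y * d y i - h y * d (r (q y)) i\<bar>)" using i1 i2 by auto
      show "integrable M (\<lambda>y. h y * (1 / N))" using i3 by auto
      fix y assume y: "y \<in> space M"
      have "\<bar>h y * d y i - h y * d (r (q y)) i\<bar> = h y * \<bar>d y i - d (r (q y)) i\<bar>"
        using h01[OF y] by (simp add: right_diff_distrib[symmetric] abs_mult)
      also have "\<dots> \<le> h y * (1 / N)" using close[OF y] h01[OF y] by (intro mult_left_mono) auto
      finally show "\<bar>h y * d y i - h y * d (r (q y)) i\<bar> \<le> h y * (1 / N)" .
    qed
    finally show ?thesis by simp
  qed
  then show ?thesis using k(1) by blast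
qed

text \<open>If \<open>h\<close> has positive integral, dividing by it gives a point that is
  approximated by \<open>K\<close> on every finite set of coordinates, hence a point of the closed
  set \<open>K\<close>. If the integral of \<open>h\<close> is zero, the approximate version forces
  all weighted integrals to vanish and any point of \<open>K\<close> works.\<close>

lemma (in prob_space) weighted_barycenter:
  fixes d :: "'a \<Rightarrow> 'i \<Rightarrow> real"
  assumes K: "mix_closed K" "closed K" and cube: "\<And>k i. k \<in> K \<Longrightarrow> k i \<in> {0..1}"
    and d: "\<And>y. y \<in> space M \<Longrightarrow> d y \<in> K" and md: "\<And>i. (\<lambda>y. d y i) \<in> borel_measurable M"
    and h: "h \<in> borel_measurable M" "\<And>y. y \<in> space M \<Longrightarrow> h y \<in> {0..1}"
  shows "\<exists>k\<in>K. \<forall>i. (\<integral>y. h y * d y i \<partial>M) = (\<integral>y. h y \<partial>M) * k i"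
proof -
  define c where "c = (\<integral>y. h y \<partial>M)"
  have approx: "\<exists>k\<in>K. \<forall>i\<in>F. \<bar>(\<integral>y. h y * d y i \<partial>M) - c * k i\<bar> \<le> c / N"
    if "finite F" "N > 0" for F and N :: nat
    unfolding c_def by (rule weighted_barycenter_approx) (use assms that in auto)
  have "c \<ge> 0" unfolding c_def using h(2) by (intro Bochner_Integration.integral_nonneg) auto
  show ?thesis
  proof (cases "c = 0")
    case True
    have "(\<integral>y. h y * d y i \<partial>M) = 0" for i
      using approx[of "{i}" 1] True by auto
    moreover obtain y where "y \<in> space M" using not_empty by blast
    ultimately show ?thesis using d[of y] True by (auto simp: c_def)
  next
    case False
    with \<open>c \<ge> 0\<close> have c: "c > 0" by simp
    define p where "p i = (\<integral>y. h y * d y i \<partial>M) / c" for i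
    have "p \<in> closure K"
    proof (rule in_closure_funI)
      fix F :: "'i set" and e :: real assume F: "finite F" and e: "e > 0"
      obtain n where n: "1 / real (Suc n) < e" using e nat_approx_posE by blast
      obtain k where k: "k \<in> K" "\<And>i. i \<in> F \<Longrightarrow> \<bar>(\<integral>y. h y * d y i \<partial>M) - c * k i\<bar> \<le> c / real (Suc n)"
        using approx[OF F, of "Suc n"] by blast
      have "\<bar>k i - p i\<bar> < e" if "i \<in> F" for i
      proof -
        have "c * \<bar>k i - p i\<bar> = \<bar>c * (k i - p i)\<bar>" using c by (simp add: abs_mult)
        also have "c * (k i - p i) = c * k i - (\<integral>y. h y * d y i \<partial>M)" using c by (simp add: p_def right_diff_distrib)
        finally have "c * \<bar>k i - p i\<bar> \<le> c * (1 / real (Suc n))" using k(2)[OF that] by simp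
        then have "\<bar>k i - p i\<bar> \<le> 1 / real (Suc n)" using c by (rule mult_left_le_imp_le)
        then show ?thesis using n by linarith
      qed
      then show "\<exists>k\<in>K. \<forall>i\<in>F. \<bar>k i - p i\<bar> < e" using k(1) by blast
    qed
    then have "p \<in> K" using K(2) by simp
    moreover have "(\<integral>y. h y * d y i \<partial>M) = c * p i" for i using c by (simp add: p_def)
    ultimately show ?thesis unfolding c_def by blast
  qed
qed

text \<open>If \<open>\<mu>\<close> is a measure on \<open>K\<close> with barycenter \<open>z\<close> and \<open>c = z i\<close>, weighting \<open>\<mu>\<close> by the \<open>i\<close>-th
  coordinate and by its complement splits \<open>z\<close> as \<open>mix c v u\<close>, and the integral of \<open>(y i - x i)\<^sup>2\<close> is
  \<open>c * u i - 2 * x i * c + (x i)\<^sup>2\<close>. For \<open>z = x\<close> extreme it vanishes, so by compactness it is small for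
  \<open>z\<close> near \<open>x\<close>.\<close>

lemma extreme_pt_concentration:
  fixes K :: "('i \<Rightarrow> real) set"
  assumes K: "compact K" and x: "extreme_pt K x" and "\<delta> > 0"
  obtains U where "open U" "x \<in> U"
    "\<And>c u v. \<lbrakk>c \<in> {0..1}; u \<in> K; v \<in> K; mix c v u \<in> U; mix c v u i = c\<rbrakk> \<Longrightarrow>
      c * u i - 2 * x i * c + (x i)\<^sup>2 < \<delta>"
proof -
  define z where "z = (\<lambda>(c, u, v). mix c v u :: 'i \<Rightarrow> real)"
  define Q where "Q = (\<lambda>(c, u :: 'i \<Rightarrow> real, v :: 'i \<Rightarrow> real). c * u i - 2 * x i * c + (x i)\<^sup>2)"
  \<comment> \<open>\<open>D\<close> is the compact set of triples that satisfy the constraint on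
    the \<open>i\<close>-th coordinate but violate the bound. Its image under \<open>z\<close> is
    closed and will be shown to miss \<open>x\<close>, so the complement of the image is the
    required neighbourhood.\<close>
  define D where "D = ({0..1} \<times> K \<times> K) \<inter> ({p. z p i = fst p} \<inter> {p. \<delta> \<le> Q p})"
  have cz: "continuous_on S z" for S
    unfolding z_def case_prod_beta by (intro continuous_on_mix continuous_intros)
  have cQ: "continuous_on S Q" for S
  proof -
    have "continuous_on S (\<lambda>p::real \<times> ('i \<Rightarrow> real) \<times> ('i \<Rightarrow> real). fst (snd p) i)"
      by (rule continuous_on_product_then_coordinatewise) (intro continuous_intros)
    then show ?thesis unfolding Q_def case_prod_beta by (intro continuous_intros)
  qed
  have "closed {p. z p i = fst p}"
    by (intro closed_Collect_eq continuous_on_product_then_coordinatewise[OF cz] continuous_intros)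
  moreover have "closed {p. \<delta> \<le> Q p}"
    by (intro closed_Collect_le cQ continuous_intros)
  ultimately have "compact D"
    unfolding D_def using K by (intro compact_Int_closed compact_Times closed_Int) auto
  then have "compact (z ` D)" using cz compact_continuous_image by blast
  then have op: "open (- z ` D)" using compact_imp_closed_fun by blast
  have "Q (c, u, v) < \<delta>" if "c \<in> {0..1}" "u \<in> K" "v \<in> K" and eq: "x = mix c v u" "mix c v u i = c" for c u v
  proof -
    have xc: "x i = c" using eq by simp
    \<comment> \<open>For \<open>0 < c < 1\<close> extremality gives \<open>u = x\<close>. For
      \<open>c = 1\<close> the mixture is \<open>u\<close> itself, and for \<open>c = 0\<close> both
      sides are zero.\<close>
    have "c * u i = c * c"
    proof (cases "c = 0 \<or> c = 1")
      case True
      then show ?thesis using eq xc by (auto simp: mix_def)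
    next
      case False
      then have "u = x" using x that by (auto simp: extreme_pt_def)
      then show ?thesis using xc by simp
    qed
    then have "Q (c, u, v) = 0" unfolding Q_def prod.case xc power2_eq_square by simp
    then show ?thesis using \<open>\<delta> > 0\<close> by simp
  qed
  then have "x \<notin> z ` D" by (force simp: D_def z_def)
  moreover have "c * u i - 2 * x i * c + (x i)\<^sup>2 < \<delta>"
    if "c \<in> {0..1}" "u \<in> K" "v \<in> K" "mix c v u \<in> - z ` D" "mix c v u i = c" for c u v
  proof (rule ccontr)
    assume "\<not> ?thesis"
    then have "(c, u, v) \<in> D" using that by (auto simp: D_def z_def Q_def)
    then have "z (c, u, v) \<in> z ` D" by blast
    then show False using that by (simp add: z_def)
  qed
  ultimately show thesis using op that[of "- z ` D"] by blast
qed

text \<open>Functionals (in practice, integration against measures on \<open>K\<close>) whose barycenter splits in \<open>K\<close>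
  along the \<open>i\<close>-th coordinate as in \<open>extreme_pt_concentration\<close>.\<close>

definition moments_in :: "('i \<Rightarrow> real) set \<Rightarrow> 'i \<Rightarrow> ((('i \<Rightarrow> real) \<Rightarrow> real) \<Rightarrow> real) set" where
  "moments_in K i = {\<Phi>. \<Phi> (\<lambda>v. v i) \<in> {0..1} \<and>
    (\<exists>u\<in>K. \<forall>j. \<Phi> (\<lambda>v. v i * v j) = \<Phi> (\<lambda>v. v i) * u j) \<and>
    (\<exists>u\<in>K. \<forall>j. \<Phi> (\<lambda>v. v j) - \<Phi> (\<lambda>v. v i * v j) = (1 - \<Phi> (\<lambda>v. v i)) * u j)}"

text \<open>The weighted masses of two functionals add up, and the two components of the split
  barycenter are averaged with weights \<open>a\<close>, \<open>b\<close> and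
  \<open>1 - t - a\<close>, \<open>t - b\<close>. Since the conditions are stated in multiplied-out
  form, vanishing masses do no harm.\<close>

lemma mix_closed_moments_in:
  fixes K :: "('i \<Rightarrow> real) set"
  assumes K: "mix_closed K"
  shows "mix_closed (moments_in K i)"
  unfolding mix_closed_def
proof (intro ballI)
  fix \<Phi> \<Psi> :: "(('i \<Rightarrow> real) \<Rightarrow> real) \<Rightarrow> real" and t :: real
  assume \<Phi>: "\<Phi> \<in> moments_in K i" and \<Psi>: "\<Psi> \<in> moments_in K i" and t: "t \<in> {0..1}"
  define a where "a = (1 - t) * \<Phi> (\<lambda>v. v i)"
  define b where "b = t * \<Psi> (\<lambda>v. v i)"
  have a: "0 \<le> a" "a \<le> 1 - t" and b: "0 \<le> b" "b \<le> t"
    using \<Phi> \<Psi> t by (auto simp: moments_in_def a_def b_def mult_left_le)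
  have m: "mix t \<Phi> \<Psi> (\<lambda>v. v i) = a + b" by (simp add: mix_def a_def b_def)
  then have zero: "mix t \<Phi> \<Psi> (\<lambda>v. v i) \<in> {0..1}" using a b by simp
  obtain u1 u2 where u: "u1 \<in> K" "u2 \<in> K" "\<And>j. \<Phi> (\<lambda>v. v i * v j) = \<Phi> (\<lambda>v. v i) * u1 j"
    "\<And>j. \<Psi> (\<lambda>v. v i * v j) = \<Psi> (\<lambda>v. v i) * u2 j" using \<Phi> \<Psi> unfolding moments_in_def by blast
  obtain v1 v2 where v: "v1 \<in> K" "v2 \<in> K"
    "\<And>j. \<Phi> (\<lambda>v. v j) - \<Phi> (\<lambda>v. v i * v j) = (1 - \<Phi> (\<lambda>v. v i)) * v1 j"
    "\<And>j. \<Psi> (\<lambda>v. v j) - \<Psi> (\<lambda>v. v i * v j) = (1 - \<Psi> (\<lambda>v. v i)) * v2 j" using \<Phi> \<Psi> unfolding moments_in_def by blast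
  obtain k where "k \<in> K" and k: "\<And>j. a * u1 j + b * u2 j = (a + b) * k j"
    using mix_closed_combination[OF K u(1,2) a(1) b(1)] by blast
  moreover have "mix t \<Phi> \<Psi> (\<lambda>v. v i * v j) = a * u1 j + b * u2 j" for j
    by (simp add: mix_def u(3,4) a_def b_def)
  ultimately have first: "\<exists>u\<in>K. \<forall>j. mix t \<Phi> \<Psi> (\<lambda>v. v i * v j) = mix t \<Phi> \<Psi> (\<lambda>v. v i) * u j"
    using m by auto
  have "1 - t - a \<ge> 0" "t - b \<ge> 0" using a b by auto
  then obtain k where "k \<in> K" and k: "\<And>j. (1 - t - a) * v1 j + (t - b) * v2 j = ((1 - t - a) + (t - b)) * k j"
    using mix_closed_combination[OF K v(1,2)] by blast
  moreover have "mix t \<Phi> \<Psi> (\<lambda>v. v j) - mix t \<Phi> \<Psi> (\<lambda>v. v i * v j) = (1 - t - a) * v1 j + (t - b) * v2 j" for j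
  proof -
    have "mix t \<Phi> \<Psi> (\<lambda>v. v j) - mix t \<Phi> \<Psi> (\<lambda>v. v i * v j) =
      (1 - t) * (\<Phi> (\<lambda>v. v j) - \<Phi> (\<lambda>v. v i * v j)) + t * (\<Psi> (\<lambda>v. v j) - \<Psi> (\<lambda>v. v i * v j))"
      unfolding mix_def by (simp add: algebra_simps)
    also have "\<dots> = (1 - t - a) * v1 j + (t - b) * v2 j"
      unfolding v(3,4) a_def b_def by (simp add: algebra_simps)
    finally show ?thesis .
  qed
  moreover have "(1 - t - a) + (t - b) = 1 - mix t \<Phi> \<Psi> (\<lambda>v. v i)" using m by simp
  ultimately have "\<exists>u\<in>K. \<forall>j. mix t \<Phi> \<Psi> (\<lambda>v. v j) - mix t \<Phi> \<Psi> (\<lambda>v. v i * v j) =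
      (1 - mix t \<Phi> \<Psi> (\<lambda>v. v i)) * u j"
    by metis
  with zero first show "mix t \<Phi> \<Psi> \<in> moments_in K i" unfolding moments_in_def by blast
qed

section \<open>The boundary of an irreducible convex system\<close>

text \<open>The group acts on functions by reindexing: \<open>g\<close> maps \<open>v\<close> to \<open>v \<circ> \<sigma> g\<close>.\<close>

locale irreducible_convex =
  fixes G :: "('g, 'b) monoid_scheme" (structure) and \<sigma> :: "'g \<Rightarrow> 'i \<Rightarrow> 'i" and K :: "('i \<Rightarrow> real) set"
  assumes G: "group G"
    and compact_K: "compact K" and K_nonempty: "K \<noteq> {}" and mix_closed_K: "mix_closed K"
    and K_cube: "\<And>k i. k \<in> K \<Longrightarrow> k i \<in> {0..1}"
    and \<sigma>_mult: "\<And>g h. g \<in> carrier G \<Longrightarrow> h \<in> carrier G \<Longrightarrow> \<sigma> h \<circ> \<sigma> g = \<sigma> (g \<otimes> h)"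
    and \<sigma>_one: "\<And>k. k \<in> K \<Longrightarrow> k \<circ> \<sigma> \<one> = k"
    and K_invariant: "\<And>k g. k \<in> K \<Longrightarrow> g \<in> carrier G \<Longrightarrow> k \<circ> \<sigma> g \<in> K"
    and K_minimal: "\<And>N. \<lbrakk>N \<subseteq> K; compact N; N \<noteq> {}; mix_closed N;
      \<And>k g. k \<in> N \<Longrightarrow> g \<in> carrier G \<Longrightarrow> k \<circ> \<sigma> g \<in> N\<rbrakk> \<Longrightarrow> N = K"
begin

lemma continuous_on_reindex: "continuous_on S (\<lambda>v::'i \<Rightarrow> real. v \<circ> \<sigma> g)"
  unfolding comp_def by (rule continuous_on_coordinatewise_then_product) (rule continuous_on_coordinate)

text \<open>This is the core of both minimality and strong proximality. Some convex combination of
  translates of the image of \<open>M\<close> under \<open>d\<close> has its barycenter close to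
  \<open>x\<close>, which makes its mean squared deviation from \<open>x\<close> small. A small
  average then yields a single translate with small deviation.\<close>

lemma extreme_pt_in_orbit_closure:
  fixes M :: "'y measure" and d :: "'y \<Rightarrow> 'i \<Rightarrow> real"
  assumes M: "prob_space M" and d: "\<And>y. y \<in> space M \<Longrightarrow> d y \<in> K"
    and md [measurable]: "\<And>i. (\<lambda>y. d y i) \<in> borel_measurable M"
    and x: "extreme_pt K x" and F: "finite F" and \<delta>: "\<delta> > 0"
  shows "\<exists>g\<in>carrier G. \<forall>i\<in>F. (\<integral>y. (d y (\<sigma> g i) - x i)\<^sup>2 \<partial>M) < \<delta>"
proof -
  interpret G: group G by (rule G)
  interpret prob_space M by (rule M)
  \<comment> \<open>\<open>\<Phi> g\<close> is integration against the \<open>g\<close>-translate of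
    the image of \<open>M\<close>. Working with functionals instead of measures lets
    \<open>mix\<close> express convex combinations.\<close>
  define \<Phi> where "\<Phi> g f = (\<integral>y. f (d y \<circ> \<sigma> g) \<partial>M)" for g and f :: "('i \<Rightarrow> real) \<Rightarrow> real"
  define E where "E = mix_hull (\<Phi> ` carrier G)"
  define bar where "bar \<Psi> = (\<lambda>i. \<Psi> (\<lambda>v. v i))" for \<Psi> :: "(('i \<Rightarrow> real) \<Rightarrow> real) \<Rightarrow> real"
  have dK: "d y \<circ> \<sigma> g \<in> K" if "y \<in> space M" "g \<in> carrier G" for y g
    using that K_invariant d by blast
  have d01: "d y i \<in> {0..1}" if "y \<in> space M" for y i using that d K_cube by blast
  have int1: "integrable M (\<lambda>y. d y i)" for i
    using d01 by (intro integrable_const_bound[where B = 1]) (auto intro!: AE_I2)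
  have int2: "integrable M (\<lambda>y. d y i * d y j)" for i j
  proof (rule integrable_const_bound[where B = 1])
    show "AE y in M. norm (d y i * d y j) \<le> 1"
    proof (rule AE_I2)
      fix y assume "y \<in> space M"
      then have "0 \<le> d y i" "d y i \<le> 1" "0 \<le> d y j" "d y j \<le> 1" using d01 by fastforce+
      then show "norm (d y i * d y j) \<le> 1" by (simp add: mult_le_one abs_mult)
    qed
  qed measurable
  have sq: "(d y i - a)\<^sup>2 = d y i * d y i - 2 * a * d y i + a\<^sup>2" for y i a
    by (simp add: power2_eq_square algebra_simps)
  have intsq: "integrable M (\<lambda>y. (d y i - a)\<^sup>2)" for i a
    unfolding sq using int1 int2 by auto

  have "\<Phi> g \<in> moments_in K i" if g: "g \<in> carrier G" for g i
  proof -
    have w: "\<exists>u\<in>K. \<forall>j. (\<integral>y. h y * (d y \<circ> \<sigma> g) j \<partial>M) = (\<integral>y. h y \<partial>M) * u j"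
      if "h \<in> borel_measurable M" "\<And>y. y \<in> space M \<Longrightarrow> h y \<in> {0..1}" for h
      by (rule weighted_barycenter)
        (use that g dK K_cube mix_closed_K compact_K in \<open>auto intro: compact_imp_closed_fun simp: comp_def\<close>)
    have "\<exists>u\<in>K. \<forall>j. \<Phi> g (\<lambda>v. v i * v j) = \<Phi> g (\<lambda>v. v i) * u j"
      using w[of "\<lambda>y. d y (\<sigma> g i)"] d01 by (simp add: \<Phi>_def)
    moreover have "\<exists>u\<in>K. \<forall>j. \<Phi> g (\<lambda>v. v j) - \<Phi> g (\<lambda>v. v i * v j) = (1 - \<Phi> g (\<lambda>v. v i)) * u j"
    proof -
      have "(\<integral>y. (1 - d y (\<sigma> g i)) * (d y \<circ> \<sigma> g) j \<partial>M) = \<Phi> g (\<lambda>v. v j) - \<Phi> g (\<lambda>v. v i * v j)" for j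
        unfolding \<Phi>_def using int1 int2 by (simp add: left_diff_distrib)
      moreover have "(\<integral>y. 1 - d y (\<sigma> g i) \<partial>M) = 1 - \<Phi> g (\<lambda>v. v i)"
        unfolding \<Phi>_def using int1 by (simp add: prob_space)
      ultimately show ?thesis using w[of "\<lambda>y. 1 - d y (\<sigma> g i)"] d01 by simp
    qed
    moreover have "\<Phi> g (\<lambda>v. v i) \<in> {0..1}"
    proof -
      have "0 \<le> \<Phi> g (\<lambda>v. v i)"
        unfolding \<Phi>_def using d01 by (intro Bochner_Integration.integral_nonneg) auto
      moreover have "\<Phi> g (\<lambda>v. v i) \<le> (\<integral>y. 1 \<partial>M)"
        unfolding \<Phi>_def comp_def using int1 d01 by (intro integral_mono) auto
      ultimately show ?thesis by (simp add: prob_space)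
    qed
    ultimately show ?thesis unfolding moments_in_def by blast
  qed
  then have Emoments: "E \<subseteq> moments_in K i" for i
    unfolding E_def by (intro mix_hull_minimal mix_closed_moments_in mix_closed_K) blast

  \<comment> \<open>A member of \<open>E\<close> is merely a function on integrands. The instances
    of linearity needed later are verified for the integrals \<open>\<Phi> g\<close> and inherited
    by their convex hull.\<close>
  have Esq: "E \<subseteq> {\<Psi>. \<Psi> (\<lambda>v. (v i - a)\<^sup>2) = \<Psi> (\<lambda>v. v i * v i) - 2 * a * \<Psi> (\<lambda>v. v i) + a\<^sup>2}" for i a
    unfolding E_def
  proof (rule mix_hull_minimal)
    show "\<Phi> ` carrier G \<subseteq> {\<Psi>. \<Psi> (\<lambda>v. (v i - a)\<^sup>2) = \<Psi> (\<lambda>v. v i * v i) - 2 * a * \<Psi> (\<lambda>v. v i) + a\<^sup>2}"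
    proof -
      have "(\<integral>y. (d y j - a)\<^sup>2 \<partial>M) = (\<integral>y. d y j * d y j \<partial>M) - 2 * a * (\<integral>y. d y j \<partial>M) + a\<^sup>2" for j
        unfolding sq using int1 int2 by (simp add: prob_space)
      then show ?thesis by (auto simp: \<Phi>_def)
    qed
  qed (clarsimp simp: mix_closed_def mix_def, simp add: algebra_simps)
  have Esum: "E \<subseteq> {\<Psi>. \<Psi> (\<lambda>v. \<Sum>i\<in>F. (v i - x i)\<^sup>2) = (\<Sum>i\<in>F. \<Psi> (\<lambda>v. (v i - x i)\<^sup>2))}"
    unfolding E_def
  proof (rule mix_hull_minimal)
    show "\<Phi> ` carrier G \<subseteq> {\<Psi>. \<Psi> (\<lambda>v. \<Sum>i\<in>F. (v i - x i)\<^sup>2) = (\<Sum>i\<in>F. \<Psi> (\<lambda>v. (v i - x i)\<^sup>2))}"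
      unfolding \<Phi>_def comp_def using intsq by (auto intro!: Bochner_Integration.integral_sum)
  qed (auto simp: mix_closed_def mix_def sum.distrib sum_distrib_left)

  have barE: "\<exists>c\<in>{0..1}. \<exists>u\<in>K. \<exists>v\<in>K. bar \<Psi> = mix c v u \<and> bar \<Psi> i = c \<and> \<Psi> (\<lambda>v. v i * v i) = c * u i"
    if \<Psi>E: "\<Psi> \<in> E" for \<Psi> i
  proof -
    obtain u v where uv: "u \<in> K" "v \<in> K" "\<Psi> (\<lambda>v. v i) \<in> {0..1}"
      "\<And>j. \<Psi> (\<lambda>v. v i * v j) = \<Psi> (\<lambda>v. v i) * u j"
      "\<And>j. \<Psi> (\<lambda>v. v j) - \<Psi> (\<lambda>v. v i * v j) = (1 - \<Psi> (\<lambda>v. v i)) * v j"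
      using Emoments[of i] \<Psi>E unfolding moments_in_def by blast
    have "bar \<Psi> = mix (\<Psi> (\<lambda>v. v i)) v u"
    proof
      fix j show "bar \<Psi> j = mix (\<Psi> (\<lambda>v. v i)) v u j"
        using uv(4)[of j] uv(5)[of j] by (simp add: bar_def mix_def)
    qed
    moreover have "bar \<Psi> i = \<Psi> (\<lambda>v. v i)" by (simp add: bar_def)
    ultimately show ?thesis using uv(1-4) by blast
  qed
  have barK: "bar \<Psi> \<in> K" if \<Psi>E: "\<Psi> \<in> E" for \<Psi>
  proof -
    \<comment> \<open>Membership in \<open>K\<close> can be read off from the splitting along any
      coordinate, so an arbitrary one is taken.\<close>
    obtain c u v where "c \<in> {0..1}" "u \<in> K" "v \<in> K" "bar \<Psi> = mix c v u"
      using barE[OF \<Psi>E, of undefined] by blast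
    then show ?thesis using mix_closed_K by (simp add: mix_closed_def)
  qed
  \<comment> \<open>The closed set of barycenters is nonempty, convex and invariant, so minimality
    of \<open>K\<close> leaves no room for a smaller set.\<close>
  have "closure (bar ` E) = K"
  proof (rule K_minimal)
    have "closed K" using compact_K compact_imp_closed_fun by blast
    then show sub: "closure (bar ` E) \<subseteq> K" using barK by (intro closure_minimal) auto
    have "compact (K \<inter> closure (bar ` E))" using compact_K by (intro compact_Int_closed) auto
    then show "compact (closure (bar ` E))" using sub by (simp add: Int_absorb1)
    have "\<Phi> \<one> \<in> E" unfolding E_def by (intro mix_hull.base) auto
    then show "closure (bar ` E) \<noteq> {}" using closure_subset by blast
    have "mix_closed (bar ` E)"
      unfolding mix_closed_def
    proof (intro ballI)
      fix u v and t :: real assume "u \<in> bar ` E" "v \<in> bar ` E" "t \<in> {0..1}"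
      then obtain \<Psi> \<Theta> where "\<Psi> \<in> E" "\<Theta> \<in> E" "u = bar \<Psi>" "v = bar \<Theta>" by blast
      moreover have "mix t (bar \<Psi>) (bar \<Theta>) = bar (mix t \<Psi> \<Theta>)" by (simp add: mix_def bar_def)
      ultimately show "mix t u v \<in> bar ` E"
        using \<open>t \<in> {0..1}\<close> unfolding E_def by (auto intro!: imageI mix_hull.mix)
    qed
    then show "mix_closed (closure (bar ` E))" by (rule mix_closed_closure)
    fix k g assume k: "k \<in> closure (bar ` E)" and g: "g \<in> carrier G"
    \<comment> \<open>Invariance: acting by \<open>g\<close> inside the integrand sends
      \<open>\<Phi> h\<close> to \<open>\<Phi> (g \<otimes> h)\<close> and commutes with
      mixtures.\<close>
    have tr: "(\<lambda>f. \<Psi> (\<lambda>v. f (v \<circ> \<sigma> g))) \<in> E" if "\<Psi> \<in> E" for \<Psi>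
      using that unfolding E_def
    proof induction
      case (base \<Psi>)
      then obtain h where h: "h \<in> carrier G" "\<Psi> = \<Phi> h" by blast
      have eq: "(\<lambda>f. \<Psi> (\<lambda>v. f (v \<circ> \<sigma> g))) = \<Phi> (g \<otimes> h)"
        unfolding h \<Phi>_def by (simp add: comp_assoc \<sigma>_mult g h)
      show ?case unfolding eq using g h by (intro mix_hull.base imageI) auto
    next
      case (mix \<Psi> \<Theta> t)
      then have "mix t (\<lambda>f. \<Psi> (\<lambda>v. f (v \<circ> \<sigma> g))) (\<lambda>f. \<Theta> (\<lambda>v. f (v \<circ> \<sigma> g))) \<in> mix_hull (\<Phi> ` carrier G)"
        by (intro mix_hull.mix)
      then show ?case by (simp add: mix_def comp_def)
    qed
    have "(\<lambda>v. v \<circ> \<sigma> g) ` closure (bar ` E) \<subseteq> closure (bar ` E)"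
    proof (rule image_closure_subset[OF continuous_on_reindex closed_closure])
      have "bar \<Psi> \<circ> \<sigma> g = bar (\<lambda>f. \<Psi> (\<lambda>v. f (v \<circ> \<sigma> g)))" for \<Psi>
        by (simp add: bar_def comp_def)
      then have "(\<lambda>v. v \<circ> \<sigma> g) ` bar ` E \<subseteq> bar ` E" using tr by (auto simp: image_iff)
      then show "(\<lambda>v. v \<circ> \<sigma> g) ` bar ` E \<subseteq> closure (bar ` E)" using closure_subset by blast
    qed
    then show "k \<circ> \<sigma> g \<in> closure (bar ` E)" using k by blast
  qed
  then have xcl: "x \<in> closure (bar ` E)" using x by (simp add: extreme_pt_def)
  \<comment> \<open>The summand 1 makes the total over \<open>F\<close> strictly less than
    \<open>\<delta>\<close> and covers empty \<open>F\<close>.\<close>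
  define \<epsilon> where "\<epsilon> = \<delta> / (card F + 1)"
  have \<epsilon>: "\<epsilon> > 0" using \<delta> by (simp add: \<epsilon>_def)
  have "\<exists>U. open U \<and> x \<in> U \<and> (\<forall>c u v. c \<in> {0..1} \<longrightarrow> u \<in> K \<longrightarrow> v \<in> K \<longrightarrow> mix c v u \<in> U \<longrightarrow>
      mix c v u i = c \<longrightarrow> c * u i - 2 * x i * c + (x i)\<^sup>2 < \<epsilon>)" for i
    by (rule extreme_pt_concentration[OF compact_K x \<epsilon>, of i]) blast
  then obtain U where U: "\<And>i. open (U i)" "\<And>i. x \<in> U i"
    "\<And>i c u v. \<lbrakk>c \<in> {0..1}; u \<in> K; v \<in> K; mix c v u \<in> U i; mix c v u i = c\<rbrakk> \<Longrightarrow>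
      c * u i - 2 * x i * c + (x i)\<^sup>2 < \<epsilon>" by metis
  have "open (\<Inter>i\<in>F. U i)" using F U by auto
  moreover have "x \<in> (\<Inter>i\<in>F. U i)" using U by auto
  ultimately obtain \<Psi> where \<Psi>: "\<Psi> \<in> E" "bar \<Psi> \<in> (\<Inter>i\<in>F. U i)"
    using xcl unfolding closure_iff_nhds_not_empty by blast
  have small: "\<Psi> (\<lambda>v. (v i - x i)\<^sup>2) < \<epsilon>" if "i \<in> F" for i
  proof -
    obtain c u v where c: "c \<in> {0..1}" "u \<in> K" "v \<in> K" "bar \<Psi> = mix c v u" "bar \<Psi> i = c"
      "\<Psi> (\<lambda>v. v i * v i) = c * u i"
      using barE[OF \<Psi>(1), of i] by blast
    moreover have "mix c v u \<in> U i" using c(4) \<Psi>(2) that by auto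
    ultimately have "c * u i - 2 * x i * c + (x i)\<^sup>2 < \<epsilon>" by (intro U(3)) auto
    moreover have "\<Psi> (\<lambda>v. (v i - x i)\<^sup>2) = \<Psi> (\<lambda>v. v i * v i) - 2 * x i * bar \<Psi> i + (x i)\<^sup>2"
      using Esq[of i "x i"] \<Psi>(1) by (auto simp: bar_def)
    ultimately show ?thesis using c by simp
  qed
  have "(\<Sum>i\<in>F. \<Psi> (\<lambda>v. (v i - x i)\<^sup>2)) \<le> card F * \<epsilon>"
    using small by (intro sum_bounded_above) (simp add: less_imp_le)
  also have "\<dots> < \<delta>" using \<delta> by (simp add: \<epsilon>_def field_simps)
  finally have total: "\<Psi> (\<lambda>v. \<Sum>i\<in>F. (v i - x i)\<^sup>2) < \<delta>" using Esum \<Psi>(1) by auto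
  \<comment> \<open>If every translate had total deviation at least \<open>\<delta>\<close>, so
    would every convex combination, including \<open>\<Psi>\<close>. The deviations are summed over
    \<open>F\<close> so that one \<open>g\<close> serves all its coordinates.\<close>
  have "\<exists>g\<in>carrier G. \<Phi> g (\<lambda>v. \<Sum>i\<in>F. (v i - x i)\<^sup>2) < \<delta>"
  proof (rule ccontr)
    assume no: "\<not> ?thesis"
    have "E \<subseteq> {\<Psi>. \<delta> \<le> \<Psi> (\<lambda>v. \<Sum>i\<in>F. (v i - x i)\<^sup>2)}"
      unfolding E_def
    proof (rule mix_hull_minimal)
      show "\<Phi> ` carrier G \<subseteq> {\<Psi>. \<delta> \<le> \<Psi> (\<lambda>v. \<Sum>i\<in>F. (v i - x i)\<^sup>2)}" using no by auto
      show "mix_closed {\<Psi>. \<delta> \<le> \<Psi> (\<lambda>v. \<Sum>i\<in>F. (v i - x i)\<^sup>2)}"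
        unfolding mix_closed_def
      proof (intro ballI CollectI)
        fix \<Psi> \<Theta> and t :: real
        assume "\<Psi> \<in> {\<Psi>. \<delta> \<le> \<Psi> (\<lambda>v. \<Sum>i\<in>F. (v i - x i)\<^sup>2)}" "\<Theta> \<in> {\<Psi>. \<delta> \<le> \<Psi> (\<lambda>v. \<Sum>i\<in>F. (v i - x i)\<^sup>2)}"
          "t \<in> {0..1}"
        then have "(1 - t) * \<delta> + t * \<delta> \<le> mix t \<Psi> \<Theta> (\<lambda>v. \<Sum>i\<in>F. (v i - x i)\<^sup>2)"
          unfolding mix_def by (intro add_mono mult_left_mono) auto
        then show "\<delta> \<le> mix t \<Psi> \<Theta> (\<lambda>v. \<Sum>i\<in>F. (v i - x i)\<^sup>2)" by (simp add: algebra_simps)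
      qed
    qed
    then show False using total \<Psi>(1) by fastforce
  qed
  then obtain g where g: "g \<in> carrier G" "\<Phi> g (\<lambda>v. \<Sum>i\<in>F. (v i - x i)\<^sup>2) < \<delta>" by blast
  then have "\<Phi> g \<in> E" unfolding E_def by (intro mix_hull.base) auto
  then have "(\<Sum>i\<in>F. \<Phi> g (\<lambda>v. (v i - x i)\<^sup>2)) < \<delta>" using Esum g(2) by auto
  moreover have "\<Phi> g (\<lambda>v. (v i - x i)\<^sup>2) \<ge> 0" for i
    unfolding \<Phi>_def by (intro Bochner_Integration.integral_nonneg) auto
  ultimately have "\<Phi> g (\<lambda>v. (v i - x i)\<^sup>2) < \<delta>" if "i \<in> F" for i
    using member_le_sum[OF that, of "\<lambda>i. \<Phi> g (\<lambda>v. (v i - x i)\<^sup>2)"] F by force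
  then show ?thesis using g(1) by (auto simp: \<Phi>_def)
qed

end

section \<open>Measurability and quadratic bounds for continuous functions\<close>

lemma continuous_map_borel_measurable_borel_of:
  fixes f :: "'x \<Rightarrow> real"
  assumes f: "continuous_map S euclideanreal f" and M: "sets M = sets (borel_of S)"
  shows "f \<in> borel_measurable M"
proof (rule borel_measurableI)
  have sets: "sets M = sigma_sets (topspace S) {U. openin S U}"
    unfolding M borel_of_def using openin_subset by (intro sets_measure_of) auto
  have space: "space M = topspace S"
    using sets_eq_imp_space_eq[OF M] unfolding borel_of_def
    by (simp add: space_measure_of_conv)
  fix U :: "real set" assume "open U"
  then have "openin S {x \<in> topspace S. f x \<in> U}" using f by (simp add: continuous_map_def)
  moreover have "f -` U \<inter> space M = {x \<in> topspace S. f x \<in> U}" using space by auto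
  ultimately show "f -` U \<inter> space M \<in> sets M" unfolding sets by (auto intro: sigma_sets.Basic)
qed

text \<open>Control of second moments thereby controls integrals of continuous functions. Inside a
  small box around \<open>x\<close> the term \<open>\<epsilon>\<close> suffices. Outside it some
  coordinate differs by at least \<open>e\<close>, and \<open>B = 2 * L / e^2\<close> makes the
  quadratic term exceed the largest possible oscillation \<open>2 * L\<close>.\<close>

lemma continuous_quadratic_bound:
  fixes C :: "('i \<Rightarrow> real) set"
  assumes C: "compact C" "x \<in> C" and f: "continuous_on C f" and \<epsilon>: "\<epsilon> > (0::real)"
  shows "\<exists>I B. finite I \<and> B \<ge> 0 \<and> (\<forall>v\<in>C. \<bar>f v - f x\<bar> \<le> \<epsilon> + B * (\<Sum>i\<in>I. (v i - x i)\<^sup>2))"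
proof -
  have "bounded (f ` C)" using C f by (intro compact_imp_bounded compact_continuous_image)
  then obtain L where L: "\<And>v. v \<in> C \<Longrightarrow> \<bar>f v\<bar> \<le> L" by (auto simp: bounded_iff)
  have L0: "0 \<le> L" using L[OF C(2)] by linarith
  obtain U where U: "open U" "U \<inter> C = f -` ball (f x) \<epsilon> \<inter> C"
    using f unfolding continuous_on_open_invariant by (metis open_ball)
  have "x \<in> U" using U(2) C(2) \<epsilon> by auto
  then obtain I e where I: "finite I" "e > 0" "\<And>y. (\<And>i. i \<in> I \<Longrightarrow> \<bar>y i - x i\<bar> < e) \<Longrightarrow> y \<in> U"
    using open_fun_contains_box[OF U(1)] by metis
  define B where "B = 2 * L / e\<^sup>2"
  have B0: "B \<ge> 0" using L0 by (simp add: B_def)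
  have "\<bar>f v - f x\<bar> \<le> \<epsilon> + B * (\<Sum>i\<in>I. (v i - x i)\<^sup>2)" if v: "v \<in> C" for v
  proof (cases "\<forall>i\<in>I. \<bar>v i - x i\<bar> < e")
    case True
    then have "v \<in> U \<inter> C" using I(3) v by blast
    then have "\<bar>f v - f x\<bar> < \<epsilon>" using U(2) by (auto simp: dist_real_def)
    moreover have "0 \<le> B * (\<Sum>i\<in>I. (v i - x i)\<^sup>2)" using B0 by (intro mult_nonneg_nonneg sum_nonneg) auto
    ultimately show ?thesis by linarith
  next
    case False
    then obtain i where i: "i \<in> I" "e \<le> \<bar>v i - x i\<bar>" by fastforce
    then have "e\<^sup>2 \<le> \<bar>v i - x i\<bar>\<^sup>2" using I(2) by (intro power_mono) auto
    also have "\<dots> = (v i - x i)\<^sup>2" by simp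
    also have "\<dots> \<le> (\<Sum>i\<in>I. (v i - x i)\<^sup>2)" using member_le_sum[OF i(1), of "\<lambda>i. (v i - x i)\<^sup>2"] I(1) by simp
    finally have "B * e\<^sup>2 \<le> B * (\<Sum>i\<in>I. (v i - x i)\<^sup>2)" using B0 by (intro mult_left_mono)
    moreover have "B * e\<^sup>2 = 2 * L" using I(2) by (simp add: B_def)
    moreover have "\<bar>f v - f x\<bar> \<le> 2 * L" using L[OF v] L[OF C(2)] by linarith
    ultimately show ?thesis using \<epsilon> by linarith
  qed
  then show ?thesis using I(1) B0 by blast
qed

section \<open>The closure of the extreme points is a boundary\<close>

context irreducible_convex
begin

definition extreme_closure :: "('i \<Rightarrow> real) set" where
  "extreme_closure = closure {x. extreme_pt K x}"

lemma closed_K: "closed K"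
  using compact_K compact_imp_closed_fun by blast

lemma extreme_closure_subset: "extreme_closure \<subseteq> K"
  unfolding extreme_closure_def using closed_K by (intro closure_minimal) (auto simp: extreme_pt_def)

lemma compact_extreme_closure: "compact extreme_closure"
proof -
  have "compact (K \<inter> extreme_closure)"
    using compact_K unfolding extreme_closure_def by (intro compact_Int_closed) auto
  then show ?thesis using extreme_closure_subset by (simp add: Int_absorb1)
qed

text \<open>The action of \<open>g\<close> on \<open>K\<close> is affine with inverse the action of
  \<open>inv g\<close>, so any decomposition of the translate pulls back to a decomposition of
  \<open>x\<close>.\<close>

lemma extreme_pt_reindex:
  assumes x: "extreme_pt K x" and g: "g \<in> carrier G"
  shows "extreme_pt K (x \<circ> \<sigma> g)"
proof -
  interpret G: group G by (rule G)
  have xK: "x \<in> K" using x by (simp add: extreme_pt_def)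
  have undo: "v \<circ> \<sigma> a \<circ> \<sigma> b = v" if "v \<in> K" "a \<in> carrier G" "b \<in> carrier G" "b \<otimes> a = \<one>" for v a b
    using \<sigma>_mult[of b a] \<sigma>_one[of v] that by (simp add: comp_assoc)
  show ?thesis
    unfolding extreme_pt_def
  proof (intro conjI ballI impI)
    show "x \<circ> \<sigma> g \<in> K" using K_invariant[OF xK g] .
    fix u v and t :: real assume uv: "u \<in> K" "v \<in> K" and t: "t \<in> {0<..<1}" and eq: "x \<circ> \<sigma> g = mix t u v"
    have "x = x \<circ> \<sigma> g \<circ> \<sigma> (inv g)" using undo[OF xK, of g "inv g"] g by simp
    also have "\<dots> = mix t (u \<circ> \<sigma> (inv g)) (v \<circ> \<sigma> (inv g))" unfolding eq by (simp add: mix_def comp_def)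
    finally have "u \<circ> \<sigma> (inv g) = x" "v \<circ> \<sigma> (inv g) = x"
      using x t K_invariant[OF uv(1)] K_invariant[OF uv(2)] g unfolding extreme_pt_def by auto
    then show "u = x \<circ> \<sigma> g" "v = x \<circ> \<sigma> g"
      using undo[OF uv(1), of "inv g" g] undo[OF uv(2), of "inv g" g] g by auto
  qed
qed

lemma extreme_closure_invariant:
  assumes "k \<in> extreme_closure" "g \<in> carrier G"
  shows "k \<circ> \<sigma> g \<in> extreme_closure"
proof -
  have "(\<lambda>v. v \<circ> \<sigma> g) ` closure {x. extreme_pt K x} \<subseteq> closure {x. extreme_pt K x}"
  proof (rule image_closure_subset[OF continuous_on_reindex closed_closure])
    have "(\<lambda>v. v \<circ> \<sigma> g) ` {x. extreme_pt K x} \<subseteq> {x. extreme_pt K x}"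
      using extreme_pt_reindex assms(2) by auto
    then show "(\<lambda>v. v \<circ> \<sigma> g) ` {x. extreme_pt K x} \<subseteq> closure {x. extreme_pt K x}"
      using closure_subset by blast
  qed
  then show ?thesis using assms(1) unfolding extreme_closure_def by blast
qed

text \<open>Minimality is the case of a point mass at \<open>k\<close>, realized by the constant map
  \<open>k\<close> on a one-point probability space.\<close>

lemma extreme_closure_minimal:
  assumes k: "k \<in> K"
  shows "extreme_closure \<subseteq> closure ((\<lambda>g. k \<circ> \<sigma> g) ` carrier G)"
  unfolding extreme_closure_def
proof (rule closure_minimal)
  show "{x. extreme_pt K x} \<subseteq> closure ((\<lambda>g. k \<circ> \<sigma> g) ` carrier G)"
  proof clarify
    fix x assume x: "extreme_pt K x"
    show "x \<in> closure ((\<lambda>g. k \<circ> \<sigma> g) ` carrier G)"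
    proof (rule in_closure_funI)
      fix F :: "'i set" and e :: real assume F: "finite F" and e: "e > 0"
      interpret P: prob_space "return (count_space UNIV) ()" by (rule prob_space_return) simp
      obtain g where g: "g \<in> carrier G" "\<And>i. i \<in> F \<Longrightarrow> (k (\<sigma> g i) - x i)\<^sup>2 < e\<^sup>2"
        using extreme_pt_in_orbit_closure[OF P.prob_space_axioms, of "\<lambda>_. k", OF k _ x F, of "e\<^sup>2"] e
          P.prob_space by auto
      have "\<bar>(k \<circ> \<sigma> g) i - x i\<bar> < e" if "i \<in> F" for i
        using power2_less_imp_less[of "\<bar>k (\<sigma> g i) - x i\<bar>" e] g(2)[OF that] e by simp
      then show "\<exists>v\<in>(\<lambda>g. k \<circ> \<sigma> g) ` carrier G. \<forall>i\<in>F. \<bar>v i - x i\<bar> < e" using g(1) by blast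
    qed
  qed
qed simp

text \<open>The injection \<open>e\<close> moves the boundary to another type, because the universal
  property of the Furstenberg boundary only ranges over spaces carried by one fixed type. The
  topology is the one making \<open>e\<close> a homeomorphism onto its image.\<close>

lemma G_boundary_extreme_closure:
  fixes e :: "('i \<Rightarrow> real) \<Rightarrow> 'y"
  assumes e: "inj e"
  defines "d \<equiv> the_inv e"
  defines "Y \<equiv> pullback_topology (e ` extreme_closure) d (top_of_set extreme_closure)"
  defines "b \<equiv> (\<lambda>g y. e (d y \<circ> \<sigma> g))"
  shows "G_boundary G Y b" and "topspace Y = e ` extreme_closure"
proof -
  have de [simp]: "d (e v) = v" for v using e by (simp add: d_def the_inv_f_f)
  show topY: "topspace Y = e ` extreme_closure"
    unfolding Y_def topspace_pullback_topology by auto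
  have dY: "d y \<in> extreme_closure" if "y \<in> topspace Y" for y using that topY by auto
  have dYK: "d y \<in> K" if "y \<in> topspace Y" for y using dY[OF that] extreme_closure_subset by blast
  have ed: "e (d y) = y" if "y \<in> topspace Y" for y using that topY by auto
  have cd: "continuous_map Y (top_of_set extreme_closure) d"
    using continuous_map_pullback[of "top_of_set extreme_closure" "top_of_set extreme_closure" id "e ` extreme_closure" d]
    unfolding Y_def by simp
  have ce: "continuous_map (top_of_set extreme_closure) Y e"
    unfolding Y_def
  proof (rule continuous_map_pullback')
    have "d \<circ> e = id" by (rule ext) simp
    then show "continuous_map (top_of_set extreme_closure) (top_of_set extreme_closure) (d \<circ> e)" by simp
  qed auto
  have hom: "homeomorphic_maps (top_of_set extreme_closure) Y e d"
    unfolding homeomorphic_maps_def using cd ce ed by simp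
  have cact: "continuous_map Y Y (b g)" if g: "g \<in> carrier G" for g
  proof -
    have "continuous_map (top_of_set extreme_closure) (top_of_set extreme_closure) (\<lambda>v. v \<circ> \<sigma> g)"
      using continuous_on_reindex extreme_closure_invariant g by (auto simp: continuous_map_in_subtopology)
    then have "continuous_map Y Y (e \<circ> (\<lambda>v. v \<circ> \<sigma> g) \<circ> d)"
      by (intro continuous_map_compose[OF cd] continuous_map_compose[OF _ ce])
    then show ?thesis by (simp add: b_def comp_def)
  qed
  have compactY: "compact_space Y"
    using homeomorphic_compact_space[OF homeomorphic_maps_imp_homeomorphic_space[OF hom]]
      compact_extreme_closure by (simp add: compact_space_subtopology)
  obtain x where x: "extreme_pt K x" using exists_extreme_pt[OF compact_K K_nonempty] by blast
  have xX: "x \<in> extreme_closure"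
    unfolding extreme_closure_def by (rule closure_subset[THEN subsetD]) (simp add: x)
  have HY: "Hausdorff_space Y"
    using homeomorphic_Hausdorff_space[OF homeomorphic_maps_imp_homeomorphic_space[OF hom]]
      Hausdorff_space_subtopology[OF Hausdorff_space_fun, of extreme_closure] by blast
  have "continuous_action G Y b"
    unfolding continuous_action_def
  proof (intro conjI ballI)
    show "b \<one> y = y" if "y \<in> topspace Y" for y using \<sigma>_one[OF dYK[OF that]] ed[OF that] by (simp add: b_def)
    show "b (g \<otimes> h) y = b g (b h y)" if "g \<in> carrier G" "h \<in> carrier G" "y \<in> topspace Y" for g h y
      using \<sigma>_mult[OF that(1,2)] by (simp add: b_def comp_assoc)
  qed (rule cact)
  then have cGs: "compact_G_space G Y b"
    unfolding compact_G_space_def using compactY HY topY xX by blast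
  have min: "minimal_action G Y b"
    unfolding minimal_action_def
  proof
    fix y assume y: "y \<in> topspace Y"
    let ?O = "(\<lambda>g. d y \<circ> \<sigma> g) ` carrier G"
    have O: "?O \<subseteq> extreme_closure" using extreme_closure_invariant[OF dY[OF y]] by blast
    have "top_of_set extreme_closure closure_of ?O = extreme_closure \<inter> closure ?O"
      using O by (simp add: closure_of_subtopology Int_absorb1)
    also have "\<dots> = extreme_closure" using extreme_closure_minimal[OF dYK[OF y]] by blast
    finally have "Y closure_of (e ` ?O) = e ` extreme_closure"
      using homeomorphic_map_closure_of[OF homeomorphic_maps_imp_map[OF hom], of ?O] O by simp
    moreover have "e ` ?O = (\<lambda>g. b g y) ` carrier G" by (auto simp: b_def)
    ultimately show "Y closure_of (\<lambda>g. b g y) ` carrier G = topspace Y" using topY by simp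
  qed
  have "strongly_proximal G Y b"
    unfolding strongly_proximal_def
  proof (intro allI impI)
    fix \<nu> :: "'y measure" assume \<nu>: "prob_measure_on Y \<nu>"
    interpret prob_space \<nu> using \<nu> by (simp add: prob_measure_on_def)
    have sets: "sets \<nu> = sets (borel_of Y)" using \<nu> by (simp add: prob_measure_on_def)
    have space: "space \<nu> = topspace Y"
      using sets_eq_imp_space_eq[OF sets] unfolding borel_of_def by (simp add: space_measure_of_conv)
    have md: "(\<lambda>y. d y i) \<in> borel_measurable \<nu>" for i
    proof (rule continuous_map_borel_measurable_borel_of[OF _ sets])
      have "continuous_map (top_of_set extreme_closure) euclideanreal (\<lambda>v. v i)"
        using continuous_on_coordinate by auto
      from continuous_map_compose[OF cd this] show "continuous_map Y euclideanreal (\<lambda>y. d y i)"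
        by (simp add: comp_def)
    qed
    \<comment> \<open>One fixed extreme point \<open>x\<close> serves for every measure
      \<open>\<nu>\<close>.\<close>
    show "\<exists>p\<in>topspace Y. \<forall>F \<epsilon>. finite F \<and> (\<forall>f\<in>F. continuous_map Y euclideanreal f) \<and> \<epsilon> > 0
        \<longrightarrow> (\<exists>g\<in>carrier G. \<forall>f\<in>F. \<bar>(\<integral>y. f (b g y) \<partial>\<nu>) - f p\<bar> < (\<epsilon>::real))"
    proof (intro bexI[of _ "e x"] allI impI)
      show "e x \<in> topspace Y" using xX topY by blast
      fix F :: "('y \<Rightarrow> real) set" and \<epsilon> :: real
      assume "finite F \<and> (\<forall>f\<in>F. continuous_map Y euclideanreal f) \<and> \<epsilon> > 0"
      then have F: "finite F" "\<And>f. f \<in> F \<Longrightarrow> continuous_map Y euclideanreal f" and \<epsilon>: "\<epsilon> > 0" by auto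
      \<comment> \<open>The index set and the constant of the quadratic bound are packed into a
        pair, so that a single choice function supplies both.\<close>
      define quad where "quad f P \<longleftrightarrow> finite (fst P) \<and> snd P \<ge> 0 \<and> (\<forall>v\<in>extreme_closure.
        \<bar>f (e v) - f (e x)\<bar> \<le> \<epsilon> / 2 + snd P * (\<Sum>i\<in>fst P. (v i - x i)\<^sup>2))" for f P
      have "\<forall>f\<in>F. \<exists>P. quad f P"
      proof
        fix f assume that: "f \<in> F"
        have "continuous_on extreme_closure (\<lambda>v. f (e v))"
          using continuous_map_compose[OF ce F(2)[OF that]] by (simp add: comp_def)
        from continuous_quadratic_bound[OF compact_extreme_closure xX this, of "\<epsilon> / 2"] \<epsilon>
        obtain I B where "quad f (I, B)" unfolding quad_def fst_conv snd_conv by auto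
        then show "\<exists>P. quad f P" by blast
      qed
      then obtain P where P: "\<forall>f\<in>F. quad f (P f)" using bchoice by blast
      define I B where "I = (\<lambda>f. fst (P f))" and "B = (\<lambda>f. snd (P f))"
      have I: "\<And>f. f \<in> F \<Longrightarrow> finite (I f)" and B: "\<And>f. f \<in> F \<Longrightarrow> B f \<ge> (0::real)"
        and IB: "\<And>f v. f \<in> F \<Longrightarrow> v \<in> extreme_closure \<Longrightarrow>
          \<bar>f (e v) - f (e x)\<bar> \<le> \<epsilon> / 2 + B f * (\<Sum>i\<in>I f. (v i - x i)\<^sup>2)"
        using P unfolding quad_def I_def B_def by auto
      define D where "D = (\<Sum>f\<in>F. B f * card (I f))"
      have D0: "D \<ge> 0" unfolding D_def using B by (intro sum_nonneg) auto
      \<comment> \<open>With this choice the quadratic error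
        \<open>B f * card (I f) * \<delta>\<close> is at most
        \<open>D * \<delta> < \<epsilon> / 2\<close> for each \<open>f\<close> in \<open>F\<close>.
        The summand 1 avoids division by zero.\<close>
      define \<delta> where "\<delta> = \<epsilon> / (2 * (D + 1))"
      have \<delta>: "\<delta> > 0" using \<epsilon> D0 by (simp add: \<delta>_def)
      \<comment> \<open>Pooling the coordinates of all test functions yields one \<open>g\<close>
        that works for the whole of \<open>F\<close>.\<close>
      have "finite (\<Union>f\<in>F. I f)" using F(1) I by blast
      then have "\<exists>g\<in>carrier G. \<forall>i\<in>(\<Union>f\<in>F. I f). (\<integral>y. (d y (\<sigma> g i) - x i)\<^sup>2 \<partial>\<nu>) < \<delta>"
        by (intro extreme_pt_in_orbit_closure[OF prob_space_axioms _ md x _ \<delta>]) (simp_all add: space dYK)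
      then obtain g where g: "g \<in> carrier G"
        and gI: "\<And>i. i \<in> (\<Union>f\<in>F. I f) \<Longrightarrow> (\<integral>y. (d y (\<sigma> g i) - x i)\<^sup>2 \<partial>\<nu>) < \<delta>" by blast
      have "\<bar>(\<integral>y. f (b g y) \<partial>\<nu>) - f (e x)\<bar> < \<epsilon>" if f: "f \<in> F" for f
      proof -
        have coord: "(d y (\<sigma> g i) - x i)\<^sup>2 \<le> 1" if "y \<in> space \<nu>" for y i
        proof -
          have "0 \<le> d y (\<sigma> g i)" "d y (\<sigma> g i) \<le> 1" "0 \<le> x i" "x i \<le> 1"
            using K_cube[OF dYK, of y "\<sigma> g i"] K_cube[of x i] x that space by (auto simp: extreme_pt_def)
          then show ?thesis by (simp add: abs_square_le_1 abs_le_iff)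
        qed
        have isq: "integrable \<nu> (\<lambda>y. (d y (\<sigma> g i) - x i)\<^sup>2)" for i
          using md coord by (intro integrable_const_bound[where B = 1]) auto
        have bound: "\<bar>f (b g y) - f (e x)\<bar> \<le> \<epsilon> / 2 + B f * (\<Sum>i\<in>I f. (d y (\<sigma> g i) - x i)\<^sup>2)"
          if "y \<in> space \<nu>" for y
          using IB[OF f extreme_closure_invariant[OF dY g]] that space by (simp add: b_def)
        have m: "(\<lambda>y. f (b g y)) \<in> borel_measurable \<nu>"
          using continuous_map_borel_measurable_borel_of[OF continuous_map_compose[OF cact[OF g] F(2)[OF f]] sets]
          by (simp add: comp_def)
        have ib: "integrable \<nu> (\<lambda>y. \<epsilon> / 2 + B f * (\<Sum>i\<in>I f. (d y (\<sigma> g i) - x i)\<^sup>2))"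
          using isq by auto
        have id: "integrable \<nu> (\<lambda>y. f (b g y) - f (e x))"
        proof (rule Bochner_Integration.integrable_bound[OF ib])
          show "AE y in \<nu>. norm (f (b g y) - f (e x)) \<le> norm (\<epsilon> / 2 + B f * (\<Sum>i\<in>I f. (d y (\<sigma> g i) - x i)\<^sup>2))"
            using bound by (intro AE_I2) fastforce
        qed (use m in measurable)
        have "integrable \<nu> (\<lambda>y. (f (b g y) - f (e x)) + f (e x))" using id by (intro Bochner_Integration.integrable_add) auto
        then have "integrable \<nu> (\<lambda>y. f (b g y))" by simp
        then have "(\<integral>y. f (b g y) \<partial>\<nu>) - f (e x) = (\<integral>y. f (b g y) - f (e x) \<partial>\<nu>)" by (simp add: prob_space)
        also have "\<bar>\<dots>\<bar> \<le> (\<integral>y. \<bar>f (b g y) - f (e x)\<bar> \<partial>\<nu>)" by (rule integral_abs_bound)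
        also have "\<dots> \<le> (\<integral>y. \<epsilon> / 2 + B f * (\<Sum>i\<in>I f. (d y (\<sigma> g i) - x i)\<^sup>2) \<partial>\<nu>)"
          using bound id ib by (intro integral_mono) auto
        also have "\<dots> = \<epsilon> / 2 + B f * (\<Sum>i\<in>I f. (\<integral>y. (d y (\<sigma> g i) - x i)\<^sup>2 \<partial>\<nu>))"
          using isq by (simp add: prob_space Bochner_Integration.integral_sum)
        also have "\<dots> \<le> \<epsilon> / 2 + B f * (card (I f) * \<delta>)"
          using gI f B[OF f] by (intro add_left_mono mult_left_mono sum_bounded_above) (auto intro!: less_imp_le)
        also have "B f * (card (I f) * \<delta>) \<le> D * \<delta>"
          using member_le_sum[OF f, of "\<lambda>f. B f * card (I f)"] B F(1) \<delta>
          by (simp add: D_def mult.assoc[symmetric] mult_right_mono)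
        also have "\<epsilon> / 2 + D * \<delta> < \<epsilon>" using \<epsilon> D0 by (simp add: \<delta>_def field_simps)
        finally show ?thesis by simp
      qed
      then show "\<exists>g\<in>carrier G. \<forall>f\<in>F. \<bar>(\<integral>y. f (b g y) \<partial>\<nu>) - f (e x)\<bar> < \<epsilon>" using g by blast
    qed
  qed
  then show "G_boundary G Y b" unfolding G_boundary_def using cGs min by blast
qed

end

section \<open>Actions of Tarski monsters\<close>

lemma tarski_monster_subgroup:
  fixes G (structure)
  assumes "tarski_monster G p" "subgroup H G" "H \<noteq> {\<one>}" "H \<noteq> carrier G"
  shows "finite H" "card H = p"
proof -
  show "card H = p" using assms by (simp add: tarski_monster_def)
  moreover have "p > 0" using assms(1) by (simp add: tarski_monster_def prime_gt_0_nat)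
  ultimately show "finite H" by (metis card.infinite less_numeral_extra(3))
qed

text \<open>The intersection is again nontrivial and proper, so it has \<open>p\<close> elements, as
  many as each of the two finite subgroups.\<close>

lemma tarski_monster_subgroup_eq:
  fixes G (structure)
  assumes T: "tarski_monster G p" and H: "subgroup H G" "H \<noteq> carrier G"
    and H': "subgroup H' G" "H' \<noteq> carrier G" and c: "c \<in> H" "c \<in> H'" "c \<noteq> \<one>"
  shows "H = H'"
proof -
  interpret group G using T by (simp add: tarski_monster_def)
  have I: "subgroup (H \<inter> H') G" using H H' subgroups_Inter_pair by blast
  have "H \<inter> H' \<noteq> {\<one>}" using c by blast
  moreover have "H \<inter> H' \<noteq> carrier G" using H subgroup.subset by blast
  moreover have "H \<noteq> {\<one>}" "H' \<noteq> {\<one>}" using c by blast+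
  ultimately have "finite H" "finite H'" "card (H \<inter> H') = p" "card H = p" "card H' = p"
    using tarski_monster_subgroup[OF T] I H H' by blast+
  then have "H \<inter> H' = H" "H \<inter> H' = H'" by (metis card_subset_eq inf_le1, metis card_subset_eq inf_le2)
  then show ?thesis by blast
qed

text \<open>Suppose \<open>H\<close> is proper and take \<open>g\<close> outside it. If
  \<open>g\<close> generated a proper subgroup \<open>C\<close>, the product of \<open>H\<close> and
  \<open>C\<close> would be a finite subgroup strictly larger than \<open>H\<close>, yet again of
  order \<open>p\<close>. So \<open>g\<close> generates the whole group, which is then infinite
  cyclic, while \<open>H\<close> supplies a nontrivial element of finite order.\<close>

lemma tarski_monster_no_normal_subgroup:
  fixes G (structure)
  assumes T: "tarski_monster G p" and H: "H \<lhd> G" "H \<noteq> {\<one>}"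
  shows "H = carrier G"
proof (rule ccontr)
  assume nH: "H \<noteq> carrier G"
  interpret group G using T by (simp add: tarski_monster_def)
  have inf: "infinite (carrier G)" using T by (simp add: tarski_monster_def)
  interpret N: normal H G by (rule H)
  have subH: "subgroup H G" by (rule N.subgroup_axioms)
  note finH = tarski_monster_subgroup[OF T subH H(2) nH]
  obtain g where g: "g \<in> carrier G" "g \<notin> H" using nH N.subset by blast
  define C where "C = generate G {g}"
  have C: "subgroup C G" unfolding C_def using g by (intro generate_is_subgroup) auto
  have gC: "g \<in> C" unfolding C_def by (rule generate.incl) simp
  have "C = carrier G"
  proof (rule ccontr)
    assume "C \<noteq> carrier G"
    moreover have "C \<noteq> {\<one>}" using gC g N.one_closed by blast
    ultimately have "finite C" using tarski_monster_subgroup[OF T C] by blast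
    then have fin: "finite (H <#> C)" using finH unfolding set_mult_def by auto
    have sub: "subgroup (H <#> C) G" using mult_norm_subgroup[OF H(1) C] .
    have "h \<otimes> \<one> \<in> H <#> C" if "h \<in> H" for h
      using that subgroup.one_closed[OF C] unfolding set_mult_def by blast
    then have HHC: "H \<subseteq> H <#> C" using N.subset by fastforce
    have "\<one> \<otimes> g \<in> H <#> C" using gC N.one_closed unfolding set_mult_def by blast
    then have gHC: "g \<in> H <#> C" using g by simp
    have "H <#> C \<noteq> carrier G" using fin inf by auto
    moreover have "H <#> C \<noteq> {\<one>}" using gHC g N.one_closed by (metis singletonD)
    ultimately have "card (H <#> C) = p" using tarski_monster_subgroup[OF T sub] by blast
    then have "H = H <#> C" using HHC fin finH by (intro card_subset_eq) auto
    then show False using gHC g by blast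
  qed
  then have "infinite (generate G {g})" using inf by (simp add: C_def)
  \<comment> \<open>Infinite order is encoded as \<open>ord g = 0\<close>, so divisibility by
    \<open>ord g\<close> below means being zero.\<close>
  then have ord0: "ord g = 0" using generate_pow_card[OF g(1)] by simp
  obtain h where h: "h \<in> H" "h \<noteq> \<one>" using H(2) N.one_closed by blast
  then have hG: "h \<in> carrier G" using N.subset by blast
  have "h \<in> generate G {g}" using hG \<open>C = carrier G\<close> by (simp add: C_def)
  then obtain k :: int where k: "h = g [^] k" using generate_pow[OF g(1)] by blast
  have "generate G {h} \<subseteq> H" using h subH by (intro generate_subgroup_incl) auto
  then have "finite (generate G {h})" using finH finite_subset by blast
  moreover have "generate G {h} \<noteq> {}" using generate.one by fast
  ultimately have "ord h \<noteq> 0" using generate_pow_card[OF hG] by simp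
  moreover have "g [^] (k * int (ord h)) = \<one>"
  proof -
    have "g [^] (k * int (ord h)) = h [^] int (ord h)" unfolding k using g by (simp add: int_pow_pow)
    also have "\<dots> = \<one>" using hG by (simp add: int_pow_int)
    finally show ?thesis .
  qed
  then have "int (ord g) dvd k * int (ord h)" using int_pow_eq_id[OF g(1)] by simp
  ultimately have "k = 0" using ord0 by simp
  then show False using k h by simp
qed

section \<open>Topological freeness of minimal actions without global fixed points\<close>

lemma tarski_monster_topologically_free:
  fixes G (structure) and S :: "'x topology"
  assumes T: "tarski_monster G p" and cG: "compact_G_space G S a" and min: "minimal_action G S a"
    and nofix: "\<And>x. x \<in> topspace S \<Longrightarrow> \<exists>g\<in>carrier G. a g x \<noteq> x"
  shows "topologically_free G S a"
  unfolding topologically_free_def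
proof (intro ballI, rule ccontr)
  interpret group G using T by (simp add: tarski_monster_def)
  have inf: "infinite (carrier G)" using T by (simp add: tarski_monster_def)
  have cont: "\<And>g. g \<in> carrier G \<Longrightarrow> continuous_map S S (a g)"
    and a1: "\<And>x. x \<in> topspace S \<Longrightarrow> a \<one> x = x"
    and am: "\<And>g h x. \<lbrakk>g \<in> carrier G; h \<in> carrier G; x \<in> topspace S\<rbrakk> \<Longrightarrow> a (g \<otimes> h) x = a g (a h x)"
    using cG by (simp_all add: compact_G_space_def continuous_action_def)
  have aS: "a g x \<in> topspace S" if "g \<in> carrier G" "x \<in> topspace S" for g x
    using cont[OF that(1)] that(2) by (auto simp: continuous_map_def)
  define stab where "stab x = {g \<in> carrier G. a g x = x}" for x
  have ainv: "a (inv g) (a g x) = x" if "g \<in> carrier G" "x \<in> topspace S" for g x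
    using am[of "inv g" g x] a1 that by simp
  have sub: "subgroup (stab x) G" if x: "x \<in> topspace S" for x
  proof (rule subgroupI)
    show "stab x \<noteq> {}" using a1 x by (auto simp: stab_def)
    show "inv g \<in> stab x" if "g \<in> stab x" for g
      using that ainv[of g x] x by (auto simp: stab_def)
    show "g \<otimes> h \<in> stab x" if "g \<in> stab x" "h \<in> stab x" for g h
      using that am[of g h x] x by (auto simp: stab_def)
  qed (auto simp: stab_def)
  have proper: "stab x \<noteq> carrier G" if "x \<in> topspace S" for x
    using nofix[OF that] by (auto simp: stab_def)
  have conj: "stab (a g x) = {h \<in> carrier G. inv g \<otimes> h \<otimes> g \<in> stab x}"
    if g: "g \<in> carrier G" and x: "x \<in> topspace S" for g x
  proof -
    have "a h (a g x) = a g x \<longleftrightarrow> a (inv g \<otimes> h \<otimes> g) x = x" if h: "h \<in> carrier G" for h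
    proof -
      have e: "a (inv g \<otimes> h \<otimes> g) x = a (inv g) (a h (a g x))"
        using g h x by (simp add: am aS)
      show ?thesis
      proof
        assume "a h (a g x) = a g x"
        then show "a (inv g \<otimes> h \<otimes> g) x = x" using e ainv[OF g x] by simp
      next
        assume "a (inv g \<otimes> h \<otimes> g) x = x"
        then have "a g (a (inv g) (a h (a g x))) = a g x" using e by simp
        then show "a h (a g x) = a g x"
          using ainv[of "inv g" "a h (a g x)"] g h x aS by simp
      qed
    qed
    then show ?thesis using g by (auto simp: stab_def)
  qed
  fix s assume s: "s \<in> carrier G - {\<one>}"
  assume ncl: "S closure_of {x \<in> topspace S. a s x \<noteq> x} \<noteq> topspace S"
  \<comment> \<open>\<open>U\<close> is the interior of the fixed point set of
    \<open>s\<close>.\<close>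
  define U where "U = topspace S - S closure_of {x \<in> topspace S. a s x \<noteq> x}"
  have opU: "openin S U" unfolding U_def by (intro openin_diff) auto
  have "S closure_of {x \<in> topspace S. a s x \<noteq> x} \<subseteq> topspace S" by (rule closure_of_subset_topspace)
  then have neU: "U \<noteq> {}" unfolding U_def using ncl by blast
  have "{x \<in> topspace S. a s x \<noteq> x} \<subseteq> S closure_of {x \<in> topspace S. a s x \<noteq> x}"
    by (rule closure_of_subset) auto
  then have fixU: "a s x = x" if "x \<in> U" for x using that unfolding U_def by blast
  \<comment> \<open>The conjugate \<open>c g\<close> fixes every point that \<open>g\<close> moves
    into \<open>U\<close>.\<close>
  define c where "c g = inv g \<otimes> s \<otimes> g" for g
  have c1: "c g \<noteq> \<one>" if g: "g \<in> carrier G" for g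
  proof
    assume "c g = \<one>"
    then have "g \<otimes> (inv g \<otimes> s \<otimes> g) \<otimes> inv g = \<one>" using g by (simp add: c_def)
    moreover have "g \<otimes> (inv g \<otimes> s \<otimes> g) \<otimes> inv g = s"
      using g s by (simp add: m_assoc[symmetric]) (simp add: m_assoc)
    ultimately show False using s by simp
  qed
  have cstab: "c g \<in> stab x" if "g \<in> carrier G" "x \<in> topspace S" "a g x \<in> U" for g x
  proof -
    have "s \<in> stab (a g x)" using fixU[OF that(3)] s by (simp add: stab_def)
    then show ?thesis using conj[OF that(1,2)] by (simp add: c_def)
  qed
  define V where "V g = {x \<in> topspace S. a g x \<in> U}" for g
  have opV: "openin S (V g)" if "g \<in> carrier G" for g
    unfolding V_def using cont[OF that] opU by (rule openin_continuous_map_preimage)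
  \<comment> \<open>Every orbit is dense and therefore meets the open set \<open>U\<close>.\<close>
  have cover: "\<exists>g\<in>carrier G. x \<in> V g" if x: "x \<in> topspace S" for x
  proof -
    obtain u where u: "u \<in> U" using neU by blast
    then have "u \<in> S closure_of ((\<lambda>g. a g x) ` carrier G)"
      using min x opU openin_subset unfolding minimal_action_def by blast
    then obtain y where "y \<in> (\<lambda>g. a g x) ` carrier G" "y \<in> U"
      using u opU unfolding in_closure_of by blast
    then show ?thesis using x by (auto simp: V_def)
  qed
  have compS: "compact_space S" using cG by (simp add: compact_G_space_def)
  have "(\<forall>W\<in>V ` carrier G. openin S W) \<and> topspace S \<subseteq> \<Union>(V ` carrier G)"
    using opV cover by blast
  then obtain \<F> where F: "finite \<F>" "\<F> \<subseteq> V ` carrier G" "topspace S \<subseteq> \<Union>\<F>"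
    using compS unfolding compact_space_alt by meson
  obtain D where D: "finite D" "D \<subseteq> carrier G" "\<F> = V ` D"
    using finite_subset_image[OF F(1,2)] by blast
  have "\<forall>x\<in>topspace S. \<exists>g\<in>D. c g \<in> stab x"
  proof
    fix x assume x: "x \<in> topspace S"
    then obtain g where g: "g \<in> D" "x \<in> V g" using F(3) D(3) by blast
    then have "c g \<in> stab x" using x D(2) by (intro cstab) (auto simp: V_def)
    then show "\<exists>g\<in>D. c g \<in> stab x" using g(1) by blast
  qed
  \<comment> \<open>Each point gets a label in the finite set \<open>D\<close>, whose conjugate lies
    in the stabilizer of the point. Points with equal labels have stabilizers sharing a nontrivial
    element, hence equal stabilizers.\<close>
  then obtain \<gamma> where \<gamma>: "\<And>x. x \<in> topspace S \<Longrightarrow> \<gamma> x \<in> D \<and> c (\<gamma> x) \<in> stab x" by metis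
  have stab_eq: "stab x = stab y" if "x \<in> topspace S" "y \<in> topspace S" "\<gamma> x = \<gamma> y" for x y
  proof (rule tarski_monster_subgroup_eq[OF T])
    show "c (\<gamma> x) \<in> stab x" "c (\<gamma> x) \<in> stab y" using \<gamma>[of x] \<gamma>[of y] that by auto
    show "c (\<gamma> x) \<noteq> \<one>" using \<gamma>[of x] that D(2) by (intro c1) blast
  qed (use sub proper that in auto)
  obtain x0 where x0: "x0 \<in> topspace S" using cG unfolding compact_G_space_def by blast
  \<comment> \<open>Infinitely many group elements send \<open>x0\<close> to points with only
    finitely many labels, so one label occurs infinitely often.\<close>
  have "finite ((\<lambda>g. \<gamma> (a g x0)) ` carrier G)"
    by (rule finite_subset[OF _ D(1)]) (use \<gamma> aS x0 in auto)
  then obtain g0 where g0: "g0 \<in> carrier G" "infinite {g \<in> carrier G. \<gamma> (a g x0) = \<gamma> (a g0 x0)}"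
    using pigeonhole_infinite[OF inf] by blast
  define y where "y = a g0 x0"
  have y: "y \<in> topspace S" using aS g0 x0 by (simp add: y_def)
  \<comment> \<open>By \<open>conj\<close> this is the normalizer of \<open>stab y\<close>.\<close>
  define N where "N = {k \<in> carrier G. stab (a k y) = stab y}"
  have "(\<lambda>g. g \<otimes> inv g0) ` {g \<in> carrier G. \<gamma> (a g x0) = \<gamma> (a g0 x0)} \<subseteq> N"
  proof clarify
    fix g assume g: "g \<in> carrier G" "\<gamma> (a g x0) = \<gamma> (a g0 x0)"
    have "a (g \<otimes> inv g0) y = a g x0"
      using am[of g "inv g0" y] ainv[OF g0(1) x0] g g0 y by (simp add: y_def)
    moreover have "stab (a g x0) = stab y" unfolding y_def
      using stab_eq[OF _ _ g(2)] aS g g0 x0 by blast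
    ultimately show "g \<otimes> inv g0 \<in> N" using g g0 by (simp add: N_def)
  qed
  moreover have "inj_on (\<lambda>g. g \<otimes> inv g0) {g \<in> carrier G. \<gamma> (a g x0) = \<gamma> (a g0 x0)}"
    using g0 by (auto simp: inj_on_def)
  ultimately have infN: "infinite N" using g0(2) finite_imageD finite_subset by blast
  \<comment> \<open>The stabilizer of \<open>a k z\<close> is a conjugate of that of
    \<open>z\<close>, so it depends on \<open>z\<close> only through \<open>stab z\<close>.\<close>
  have tr: "stab (a k z) = stab (a k z')" if "k \<in> carrier G" "z \<in> topspace S" "z' \<in> topspace S" "stab z = stab z'" for k z z'
    using conj that by simp
  have "subgroup N G"
  proof (rule subgroupI)
    show "N \<noteq> {}" using infN by auto
    show "inv k \<in> N" if "k \<in> N" for k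
    proof -
      have k: "k \<in> carrier G" "stab (a k y) = stab y" using that by (auto simp: N_def)
      have "stab (a (inv k) (a k y)) = stab (a (inv k) y)" using k y aS by (intro tr) auto
      then show ?thesis using k ainv[OF k(1) y] by (simp add: N_def)
    qed
    show "k \<otimes> l \<in> N" if "k \<in> N" "l \<in> N" for k l
    proof -
      have k: "k \<in> carrier G" "stab (a k y) = stab y" "l \<in> carrier G" "stab (a l y) = stab y"
        using that by (auto simp: N_def)
      have "stab (a k (a l y)) = stab (a k y)" using k y aS by (intro tr) auto
      then show ?thesis using k y am by (simp add: N_def)
    qed
  qed (auto simp: N_def)
  then have NG: "N = carrier G"
    using tarski_monster_subgroup(1)[OF T] infN by (metis finite.emptyI finite_insert)
  have "stab y \<lhd> G"
    unfolding normal_inv_iff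
  proof (intro conjI ballI sub[OF y])
    fix g h assume g: "g \<in> carrier G" and h: "h \<in> stab y"
    have "inv g \<in> N" using g NG by simp
    then have "h \<in> stab (a (inv g) y)" using h by (simp add: N_def)
    then show "g \<otimes> h \<otimes> inv g \<in> stab y" using conj[of "inv g" y] g y by simp
  qed
  moreover have "stab y \<noteq> {\<one>}" using \<gamma>[OF y] c1 D(2) by blast
  ultimately show False using tarski_monster_no_normal_subgroup[OF T] proper[OF y] by blast
qed

section \<open>Means\<close>

text \<open>Means are defined on all subsets of the type; the second condition makes them depend only on the
  part of a set inside the carrier.\<close>

definition means :: "('g, 'b) monoid_scheme \<Rightarrow> ('g set \<Rightarrow> real) set" where
  "means G = {m. (\<forall>A. m A \<in> {0..1}) \<and> (\<forall>A. m A = m (A \<inter> carrier G)) \<and> m (carrier G) = 1 \<and>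
     (\<forall>A B. A \<inter> B = {} \<longrightarrow> m (A \<union> B) = m A + m B)}"

text \<open>Preimages are used because composing a mean with them is its push-forward under left
  translation. They reverse composition, which matches the order in
  \<open>\<sigma>_mult\<close>.\<close>

definition translate_preimage :: "('g, 'b) monoid_scheme \<Rightarrow> 'g \<Rightarrow> 'g set \<Rightarrow> 'g set" where
  "translate_preimage G g A = {h \<in> carrier G. g \<otimes>\<^bsub>G\<^esub> h \<in> A}"

text \<open>Each defining identity involves at most three values of \<open>m\<close> and hence cuts
  out a closed subset of the compact cube.\<close>

lemma compact_means: "compact (means G)"
proof -
  have cc: "continuous_on UNIV (\<lambda>m::'a set \<Rightarrow> real. m A)" for A by (rule continuous_on_coordinate)
  have "closed {m::'a set \<Rightarrow> real. m A = m (A \<inter> carrier G)}" for A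
    by (intro closed_Collect_eq cc)
  then have 1: "closed (\<Inter>A. {m::'a set \<Rightarrow> real. m A = m (A \<inter> carrier G)})" by blast
  have 2: "closed {m::'a set \<Rightarrow> real. m (carrier G) = 1}" by (intro closed_Collect_eq cc continuous_on_const)
  have "closed {m::'a set \<Rightarrow> real. m (A \<union> B) = m A + m B}" for A B
    by (intro closed_Collect_eq continuous_on_add cc)
  then have 3: "closed (\<Inter>(A, B)\<in>{(A, B). A \<inter> B = {}}. {m::'a set \<Rightarrow> real. m (A \<union> B) = m A + m B})"
    by (intro closed_INT) auto
  have "means G = {m. \<forall>A. m A \<in> {0..1}} \<inter> ((\<Inter>A. {m. m A = m (A \<inter> carrier G)}) \<inter> ({m. m (carrier G) = 1} \<inter>
      (\<Inter>(A, B)\<in>{(A, B). A \<inter> B = {}}. {m. m (A \<union> B) = m A + m B})))"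
    unfolding means_def by auto
  also have "compact \<dots>"
    by (intro compact_Int_closed compact_unit_cube closed_Int 1 2 3)
  finally show ?thesis .
qed

lemma mix_closed_means: "mix_closed (means G)"
  unfolding mix_closed_def
proof (intro ballI)
  fix u v and t :: real assume uv: "u \<in> means G" "v \<in> means G" and t: "t \<in> {0..1}"
  have "mix t u v A \<in> {0..1}" for A
  proof -
    have "0 \<le> u A" "u A \<le> 1" "0 \<le> v A" "v A \<le> 1" using uv by (auto simp: means_def)
    moreover from this t have "(1 - t) * u A + t * v A \<le> (1 - t) * 1 + t * 1"
      by (intro add_mono mult_left_mono) auto
    ultimately show ?thesis using t by (auto simp: mix_def)
  qed
  moreover have "mix t u v A = mix t u v (A \<inter> carrier G)" for A
  proof -
    have "u A = u (A \<inter> carrier G)" "v A = v (A \<inter> carrier G)" using uv unfolding means_def by blast+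
    then show ?thesis by (simp add: mix_def)
  qed
  moreover have "mix t u v (A \<union> B) = mix t u v A + mix t u v B" if "A \<inter> B = {}" for A B
  proof -
    have "u (A \<union> B) = u A + u B" "v (A \<union> B) = v A + v B" using uv that unfolding means_def by blast+
    then show ?thesis by (simp add: mix_def algebra_simps)
  qed
  moreover have "mix t u v (carrier G) = 1" using uv by (simp add: mix_def means_def)
  ultimately show "mix t u v \<in> means G" unfolding means_def by blast
qed

lemma dirac_in_means: "group G \<Longrightarrow> (\<lambda>A. if \<one>\<^bsub>G\<^esub> \<in> A then 1 else 0) \<in> means G"
  by (auto simp: means_def group.is_monoid monoid.one_closed)

lemma means_translate:
  fixes G (structure)
  assumes "group G" "m \<in> means G" "g \<in> carrier G"
  shows "m \<circ> translate_preimage G g \<in> means G"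
proof -
  interpret group G by fact
  have "translate_preimage G g (A \<union> B) = translate_preimage G g A \<union> translate_preimage G g B" for A B
    by (auto simp: translate_preimage_def)
  moreover have "translate_preimage G g A \<inter> translate_preimage G g B = {}" if "A \<inter> B = {}" for A B
    using that by (auto simp: translate_preimage_def)
  moreover have "translate_preimage G g (A \<inter> carrier G) = translate_preimage G g A" for A
    using assms(3) by (auto simp: translate_preimage_def)
  moreover have "translate_preimage G g (carrier G) = carrier G"
    using assms(3) by (auto simp: translate_preimage_def)
  ultimately show ?thesis using assms(2) unfolding means_def by simp
qed

lemma translate_preimage_mult:
  fixes G (structure)
  assumes "group G" "g \<in> carrier G" "h \<in> carrier G"
  shows "translate_preimage G h \<circ> translate_preimage G g = translate_preimage G (g \<otimes> h)"
proof -
  interpret group G by fact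
  show ?thesis using assms by (auto simp: translate_preimage_def fun_eq_iff m_assoc)
qed

lemma exists_irreducible_means:
  assumes G: "group G"
  shows "\<exists>K\<subseteq>means G. irreducible_convex G (translate_preimage G) K"
proof -
  interpret group G by fact
  define Q where "Q N \<longleftrightarrow> mix_closed N \<and> (\<forall>k\<in>N. \<forall>g\<in>carrier G. k \<circ> translate_preimage G g \<in> N)" for N
  have Q0: "Q (means G)" using mix_closed_means means_translate[OF G] by (simp add: Q_def)
  have QI: "Q (\<Inter>\<F>)" if "\<F> \<noteq> {}" "\<forall>N\<in>\<F>. Q N" for \<F>
    using that unfolding Q_def mix_closed_def by simp
  have ne: "means G \<noteq> {}" using dirac_in_means[OF G] by blast
  obtain K where K: "K \<subseteq> means G" "compact K" "K \<noteq> {}" "Q K"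
    "\<forall>N\<subseteq>K. compact N \<and> N \<noteq> {} \<and> Q N \<longrightarrow> N = K"
    using exists_minimal_compact[of "means G" Q, OF compact_means ne Q0 QI] by auto
  have "irreducible_convex G (translate_preimage G) K"
  proof
    show "k i \<in> {0..1}" if "k \<in> K" for k i using that K(1) unfolding means_def by blast
    show "k \<circ> translate_preimage G \<one>\<^bsub>G\<^esub> = k" if "k \<in> K" for k
    proof
      fix A
      \<comment> \<open>Translation by the identity discards the points outside the carrier, which a
        mean does not see. This is why the identity law is only asked for on
        \<open>K\<close>.\<close>
      have "translate_preimage G \<one>\<^bsub>G\<^esub> A = A \<inter> carrier G" by (auto simp: translate_preimage_def)
      then show "(k \<circ> translate_preimage G \<one>\<^bsub>G\<^esub>) A = k A" using that K(1) unfolding means_def by fastforce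
    qed
  qed (use K translate_preimage_mult[OF G] in \<open>auto simp: Q_def\<close>)
  then show ?thesis using K(1) by blast
qed

lemma invariant_mean_imp_amenable:
  assumes G: "group G" and m: "m \<in> means G" and inv: "\<And>g. g \<in> carrier G \<Longrightarrow> m \<circ> translate_preimage G g = m"
  shows "amenable_group G"
  unfolding amenable_group_def
proof (intro exI[of _ m] conjI allI impI ballI)
  interpret group G by fact
  show "m A \<ge> 0" for A using m by (simp add: means_def)
  show "m (carrier G) = 1" using m by (simp add: means_def)
  show "m (A \<union> B) = m A + m B" if "A \<subseteq> carrier G \<and> B \<subseteq> carrier G \<and> A \<inter> B = {}" for A B
    using m that by (simp add: means_def)
  fix g A assume g: "g \<in> carrier G" and A: "A \<subseteq> carrier G"
  \<comment> \<open>Invariance evaluated at the left translate of \<open>A\<close> thus compares the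
    means of the translate and of \<open>A\<close>.\<close>
  have "translate_preimage G g ((\<lambda>h. g \<otimes>\<^bsub>G\<^esub> h) ` A) = A"
    using g A by (auto simp: translate_preimage_def subset_iff)
  then show "m ((\<lambda>h. g \<otimes>\<^bsub>G\<^esub> h) ` A) = m A" using fun_cong[OF inv[OF g], of "(\<lambda>h. g \<otimes>\<^bsub>G\<^esub> h) ` A"] by simp
qed

text \<open>A function is encoded by the pairs (rational, argument) lying strictly below its graph.\<close>

lemma inj_real_fun_set_set:
  assumes inf: "infinite (UNIV :: 'g set)"
  shows "\<exists>e :: ('g set \<Rightarrow> real) \<Rightarrow> 'g set set. inj e"
proof -
  have "|UNIV :: nat set| \<le>o |UNIV :: 'g set|" using inf infinite_iff_card_of_nat by blast
  then have "|(UNIV :: nat set) <+> (UNIV :: 'g set)| =o |UNIV :: 'g set|"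
    using card_of_Plus_infinite2 inf by blast
  then have "\<exists>h :: nat + 'g \<Rightarrow> 'g. inj_on h ((UNIV :: nat set) <+> (UNIV :: 'g set)) \<and> h ` (UNIV <+> UNIV) \<subseteq> UNIV"
    unfolding card_of_ordLeq by (rule ordIso_imp_ordLeq)
  then obtain h :: "nat + 'g \<Rightarrow> 'g" where h: "inj h" by auto
  define r where "r n = (of_rat (from_nat n) :: real)" for n
  \<comment> \<open>\<open>c n A\<close> codes the pair of \<open>n\<close> and \<open>A\<close> as
    one subset of the infinite type, through the injection \<open>h\<close> of the disjoint sum with
    the naturals.\<close>
  define c where "c n A = h ` ({Inl n} \<union> Inr ` A)" for n A
  have c: "n = n' \<and> A = A'" if "c n A = c n' A'" for n n' A A'
  proof -
    have "{Inl n} \<union> Inr ` A = {Inl n'} \<union> Inr ` A'" using that unfolding c_def inj_image_eq_iff[OF h] .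
    then show ?thesis by (auto simp: set_eq_iff)
  qed
  define e where "e v = {c n A |n A. r n < v A}" for v
  have mem: "c n A \<in> e v \<longleftrightarrow> r n < v A" for n A v unfolding e_def using c by blast
  have "inj e"
  proof (rule injI, rule ext, rule ccontr)
    fix u v A assume eq: "e u = e v" and ne: "u A \<noteq> v A"
    then have iff: "r n < u A \<longleftrightarrow> r n < v A" for n using mem by metis
    have "min (u A) (v A) < max (u A) (v A)" using ne by (simp add: min_def max_def)
    then obtain q :: rat where q: "min (u A) (v A) < of_rat q" "of_rat q < max (u A) (v A)"
      using of_rat_dense by blast
    obtain n where "r n = of_rat q" unfolding r_def by (metis from_nat_to_nat)
    then show False using iff[of n] q by (auto simp: min_def max_def split: if_splits)
  qed
  then show ?thesis by blast
qed

section \<open>A global fixed point would produce an invariant mean\<close>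

theorem theorem6p5:
  fixes G :: "('g, 'b) monoid_scheme" and p :: nat
    and S :: "'x topology" and a :: "'g \<Rightarrow> 'x \<Rightarrow> 'x"
  assumes "tarski_monster G p"
    and "furstenberg_boundary G S a"
  shows "topologically_free G S a"
proof (rule tarski_monster_topologically_free[OF assms(1)])
  have G: "group G" and inf: "infinite (carrier G)" and nam: "\<not> amenable_group G"
    using assms(1) by (simp_all add: tarski_monster_def)
  have bd: "G_boundary G S a"
    and univ: "\<And>(Y :: 'g set set topology) b. G_boundary G Y b \<Longrightarrow> \<exists>\<pi>. equivariant_factor G S a Y b \<pi>"
    using assms(2) unfolding furstenberg_boundary_def by blast+
  show "compact_G_space G S a" "minimal_action G S a" using bd by (simp_all add: G_boundary_def)
  show "\<exists>g\<in>carrier G. a g x \<noteq> x" if x: "x \<in> topspace S" for x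
  proof (rule ccontr)
    assume "\<not> (\<exists>g\<in>carrier G. a g x \<noteq> x)"
    \<comment> \<open>The orbit of a global fixed point is a single point, closed because the space
      is Hausdorff and dense by minimality.\<close>
    then have "(\<lambda>g. a g x) ` carrier G = {x}" using group.is_monoid[OF G] monoid.one_closed by fastforce
    then have "S closure_of {x} = topspace S"
      using \<open>minimal_action G S a\<close> x unfolding minimal_action_def by metis
    moreover have "closedin S {x}"
      using bd x by (simp add: G_boundary_def compact_G_space_def closedin_Hausdorff_singleton)
    ultimately have S: "topspace S = {x}" by (simp add: closure_of_closedin)
    obtain K where K: "K \<subseteq> means G" "irreducible_convex G (translate_preimage G) K"
      using exists_irreducible_means[OF G] by blast
    interpret irreducible_convex G "translate_preimage G" K by (rule K(2))
    obtain e :: "('g set \<Rightarrow> real) \<Rightarrow> 'g set set" where e: "inj e"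
      using inj_real_fun_set_set inf finite_subset subset_UNIV by metis
    \<comment> \<open>Universality maps the one-point boundary onto the boundary of means, which
      therefore consists of a single mean. Invariance of \<open>extreme_closure\<close> makes that
      mean invariant.\<close>
    obtain \<pi> where "\<pi> ` topspace S = e ` extreme_closure"
      using univ[OF G_boundary_extreme_closure(1)[OF e]] G_boundary_extreme_closure(2)[OF e]
      unfolding equivariant_factor_def by auto
    then have img: "e ` extreme_closure = {\<pi> x}" using S by simp
    then obtain m where m: "m \<in> extreme_closure" by blast
    have uniq: "k = m" if "k \<in> extreme_closure" for k
    proof -
      have "e k \<in> e ` extreme_closure" "e m \<in> e ` extreme_closure" using that m by blast+
      then have "e k = e m" unfolding img by simp
      then show ?thesis using e by (simp add: inj_eq)
    qed
    have "amenable_group G"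
    proof (rule invariant_mean_imp_amenable[OF G])
      show "m \<in> means G" using m extreme_closure_subset K(1) by blast
      show "m \<circ> translate_preimage G g = m" if "g \<in> carrier G" for g
        using uniq extreme_closure_invariant[OF m that] by blast
    qed
    then show False using nam by blast
  qed
qed

end
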